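(* Let $E\subset\mathbb{H}^n$ be a $t$-convex and compact set satisfying the condition (NC) for all $p\in\partial E$ there exists $q\in\partial E$ such that $d(p,q)=\operatorname{diam}E$. Let $f^\pm$, $U$, $\hat E$ be associated with $E$ as in the context. Then the following properties hold. (i) The set $U$ is open in $\mathbb{C}^n$, and the maps $f^-$ and $f^+$ are locally Lipschitz on $U$ and continuous on $\pi(E)$. (ii) $\mathcal{L}^{2n+1}(E)=\mathcal{L}^{2n+1}(\hat E)$. (iii) We have $$\operatorname{int}E=\operatorname{int}\hat E=\{[z,t]\in\mathbb{H}^n : z\in U,\ f^-(z)<t<f^+(z)\},$$ $$\partial\hat E=\{[z,f^{\pm}(z)]\in\mathbb{H}^n : z\in\overline U\},\qquad \hat E=\overline{\operatorname{int}E}.$$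
   Context: Let $n\ge 1$. The Heisenberg group is $\mathbb{H}^n=\mathbb{C}^n\times\mathbb{R}\approx\mathbb{R}^{2n+1}$ with points $[z,t]$, $z=(z_1,\dots,z_n)$, $z_j=x_j+iy_j$, and group law $[z,t]\cdot[z',t']=[z+z',\,t+t'+2\operatorname{Im} z\overline{z}']$, where $\operatorname{Im} z\overline z'=\sum_j\operatorname{Im} z_j\overline{z}'_j$. Put $X_j=\partial_{x_j}+2y_j\partial_t$, $Y_j=\partial_{y_j}-2x_j\partial_t$. A curve is horizontal if it is absolutely continuous and its tangent vector lies a.e. in $\operatorname{span}\{X_j,Y_j\}_{j}$. Fix the left-invariant Riemannian metric making $(X_1,\dots,X_n,Y_1,\dots,Y_n,\partial_t)$ orthonormal; the Carnot-Carathéodory distance $d(p,q)$ is the infimum of the Riemannian lengths of horizontal curves joining $p$ to $q$. It induces the usual topology. Diameters are with respect to $d$; $\mathcal{L}^{2n+1}$ is Lebesgue measure on $\mathbb{R}^{2n+1}$; $\pi([z,t])=z$. A set $F\subset\mathbb{H}^n$ is $t$-convex if, whenever $[z,t_1],[z,t_2]\in F$ with $t_1\le t_2$, also $[z,t]\in F$ for all $t\in[t_1,t_2]$. For a compact set $E\subset\mathbb{H}^n$ and $z\in\pi(E)$: $f^+(z)=\max\{t : [z,t]\in E\}$, $f^-(z)=\min\{t : [z,t]\in E\}$; $U=\{z\in\pi(E) : f^-(z)<f^+(z)\}$; $\hat E=\{[z,t]\in\mathbb{H}^n : z\in\overline U,\ f^-(z)\le t\le f^+(z)\}$ (note $\overline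 U\subset\pi(E)$). *)

theory Defs
  imports "HOL-Analysis.Analysis"
begin

type_synonym 'n heis = "(complex, 'n) vec \<times> real"

definition heis_mult :: "'n::finite heis \<Rightarrow> 'n heis \<Rightarrow> 'n heis" where
  "heis_mult p q =
     (fst p + fst q, snd p + snd q + 2 * Im (\<Sum>j\<in>UNIV. fst p $ j * cnj (fst q $ j)))"

text \<open>
  Tangent vectors at any point are identified with elements of the ambient vector space:
  \<open>(axis j 1, 0)\<close> is \<open>\<partial>/\<partial>x\<^sub>j\<close>, \<open>(axis j \<i>, 0)\<close> is \<open>\<partial>/\<partial>y\<^sub>j\<close> and \<open>(0, 1)\<close> is \<open>\<partial>/\<partial>t\<close>.
\<close>

definition heis_X :: "'n::finite \<Rightarrow> 'n heis \<Rightarrow> 'n heis" where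
  "heis_X j p = (axis j 1, 2 * Im (fst p $ j))"

definition heis_Y :: "'n::finite \<Rightarrow> 'n heis \<Rightarrow> 'n heis" where
  "heis_Y j p = (axis j \<i>, - 2 * Re (fst p $ j))"

definition heis_T :: "'n::finite heis" where
  "heis_T = (0, 1)"

definition horizontal_space :: "'n::finite heis \<Rightarrow> 'n heis set" where
  "horizontal_space p = span (range (\<lambda>j. heis_X j p) \<union> range (\<lambda>j. heis_Y j p))"

text \<open>
  The coefficients of \<open>v\<close> in the frame \<open>X\<^sub>j, Y\<^sub>j, \<partial>/\<partial>t\<close> at \<open>p\<close> are \<open>Re (fst v $ j)\<close>, \<open>Im (fst v $ j)\<close>
  and \<open>vertical_coeff p v\<close>.  Hence \<open>heis_metric\<close> is the Riemannian metric for which the frame is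
  orthonormal, see \<open>heis_metric_unique\<close> below.
\<close>

definition vertical_coeff :: "'n::finite heis \<Rightarrow> 'n heis \<Rightarrow> real" where
  "vertical_coeff p v = snd v
     - (\<Sum>j\<in>UNIV. Re (fst v $ j) * (2 * Im (fst p $ j)) + Im (fst v $ j) * (- 2 * Re (fst p $ j)))"

definition heis_metric :: "'n::finite heis \<Rightarrow> 'n heis \<Rightarrow> 'n heis \<Rightarrow> real" where
  "heis_metric p v w =
     (\<Sum>j\<in>UNIV. Re (fst v $ j) * Re (fst w $ j) + Im (fst v $ j) * Im (fst w $ j))
     + vertical_coeff p v * vertical_coeff p w"

definition heis_frame :: "'n::finite heis \<Rightarrow> 'n heis set" where
  "heis_frame p = range (\<lambda>j. heis_X j p) \<union> range (\<lambda>j. heis_Y j p) \<union> {heis_T}"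

lemma vec_axis_expand:
  "(z :: complex ^ 'n) = (\<Sum>j\<in>UNIV. Re (z $ j) *\<^sub>R axis j 1 + Im (z $ j) *\<^sub>R axis j \<i>)"
proof -
  have "(\<Sum>j\<in>UNIV. Re (z $ j) *\<^sub>R axis j 1 + Im (z $ j) *\<^sub>R axis j \<i>) $ i = z $ i" for i
  proof -
    have "(\<Sum>j\<in>UNIV. Re (z $ j) *\<^sub>R axis j 1 + Im (z $ j) *\<^sub>R axis j \<i>) $ i
        = (\<Sum>j\<in>UNIV. if j = i then z $ i else 0)"
      unfolding sum_component
      by (rule sum.cong) (auto simp: axis_def complex_eq_iff)
    then show ?thesis by simp
  qed
  then show ?thesis by (simp add: vec_eq_iff)
qed

lemma heis_frame_expand:
  "v = (\<Sum>j\<in>UNIV. Re (fst v $ j) *\<^sub>R heis_X j p + Im (fst v $ j) *\<^sub>R heis_Y j p)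
       + vertical_coeff p v *\<^sub>R heis_T"
  by (rule prod_eqI)
    (simp_all add: fst_sum snd_sum heis_X_def heis_Y_def heis_T_def vertical_coeff_def
      vec_axis_expand[symmetric])

lemma span_heis_frame: "span (heis_frame p) = UNIV"
proof -
  have "v \<in> span (heis_frame p)" for v
    by (subst heis_frame_expand[of v p])
      (intro span_add span_sum span_scale span_base; simp add: heis_frame_def)
  then show ?thesis by blast
qed

lemma linear_vertical_coeff: "linear (vertical_coeff p)"
  by (rule linearI)
    (simp_all add: vertical_coeff_def algebra_simps sum.distrib sum_distrib_left sum_subtractf)

lemma heis_metric_inner:
  "heis_metric p v w = fst v \<bullet> fst w + vertical_coeff p v * vertical_coeff p w"
  by (simp add: heis_metric_def inner_vec_def inner_complex_def)

lemma bilinear_heis_metric: "bilinear (heis_metric p)"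
  unfolding bilinear_def heis_metric_inner
  by (intro conjI allI linearI)
    (simp_all add: linear_add[OF linear_vertical_coeff] linear_cmul[OF linear_vertical_coeff]
      inner_add_left inner_add_right distrib_left distrib_right)

lemma sum_axis:
  fixes f :: "'n::finite \<Rightarrow> real"
  shows "(\<Sum>i\<in>UNIV. Re ((axis j c :: complex ^ 'n) $ i) * f i
           + Im ((axis j c :: complex ^ 'n) $ i) * g i) = Re c * f j + Im c * g j"
proof -
  have "(\<Sum>i\<in>UNIV. Re ((axis j c :: complex ^ 'n) $ i) * f i
           + Im ((axis j c :: complex ^ 'n) $ i) * g i)
      = (\<Sum>i\<in>UNIV. if i = j then Re c * f j + Im c * g j else 0)"
    by (rule sum.cong) (auto simp: axis_def)
  then show ?thesis by simp
qed

lemma vertical_coeff_frame [simp]: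
  "vertical_coeff p (heis_X j p) = 0" "vertical_coeff p (heis_Y j p) = 0"
  "vertical_coeff p heis_T = 1"
  unfolding vertical_coeff_def heis_X_def heis_Y_def heis_T_def fst_conv snd_conv sum_axis
  by simp_all

lemma heis_frame_orthonormal:
  "heis_metric p (heis_X i p) (heis_X j p) = (if i = j then 1 else 0)"
  "heis_metric p (heis_Y i p) (heis_Y j p) = (if i = j then 1 else 0)"
  "heis_metric p (heis_X i p) (heis_Y j p) = 0"
  "heis_metric p (heis_Y j p) (heis_X i p) = 0"
  "heis_metric p (heis_X i p) heis_T = 0" "heis_metric p heis_T (heis_X i p) = 0"
  "heis_metric p (heis_Y i p) heis_T = 0" "heis_metric p heis_T (heis_Y i p) = 0"
  "heis_metric p heis_T heis_T = 1"
  unfolding heis_metric_inner vertical_coeff_frame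
  by (simp_all add: heis_X_def heis_Y_def heis_T_def inner_axis_axis)

lemma heis_metric_unique:
  assumes "bilinear g"
    and "\<And>i j. g (heis_X i p) (heis_X j p) = (if i = j then 1 else 0)"
    and "\<And>i j. g (heis_Y i p) (heis_Y j p) = (if i = j then 1 else 0)"
    and "\<And>i j. g (heis_X i p) (heis_Y j p) = 0" "\<And>i j. g (heis_Y j p) (heis_X i p) = 0"
    and "\<And>i. g (heis_X i p) heis_T = 0" "\<And>i. g heis_T (heis_X i p) = 0"
    and "\<And>i. g (heis_Y i p) heis_T = 0" "\<And>i. g heis_T (heis_Y i p) = 0"
    and "g heis_T heis_T = 1"
  shows "g = heis_metric p"
proof (intro ext)
  fix v w
  have frame: "g x y = heis_metric p x y" if "x \<in> heis_frame p" "y \<in> heis_frame p" for x y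
    using that assms(2-) by (auto simp: heis_frame_def heis_frame_orthonormal)
  show "g v w = heis_metric p v w"
    by (rule bilinear_eq[OF assms(1) bilinear_heis_metric, of UNIV "heis_frame p" UNIV "heis_frame p"])
      (simp_all only: span_heis_frame order.refl UNIV_I frame)
qed

text \<open>
  The frame, and hence the metric, is invariant under left translations: the differential of
  \<open>heis_mult p\<close> does not depend on the base point and maps the frame at \<open>q\<close> to the frame at
  \<open>heis_mult p q\<close>.
\<close>

definition heis_left_diff :: "'n::finite heis \<Rightarrow> 'n heis \<Rightarrow> 'n heis" where
  "heis_left_diff p v = (fst v, snd v + 2 * Im (\<Sum>j\<in>UNIV. fst p $ j * cnj (fst v $ j)))"

lemma heis_mult_has_derivative: "(heis_mult p has_derivative heis_left_diff p) (at q)"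
proof -
  have "linear (heis_left_diff p)"
    by (rule linearI)
      (simp_all add: heis_left_diff_def distrib_left mult.left_commute sum.distrib
        flip: sum_distrib_left)
  then have "(heis_left_diff p has_derivative heis_left_diff p) (at q)"
    by (simp add: linear_conv_bounded_linear bounded_linear_imp_has_derivative)
  then have "((\<lambda>q. p + heis_left_diff p q) has_derivative heis_left_diff p) (at q)"
    using has_derivative_add[OF has_derivative_const] by fastforce
  moreover have "heis_mult p = (\<lambda>q. p + heis_left_diff p q)"
    by (auto simp: heis_mult_def heis_left_diff_def prod_eq_iff)
  ultimately show ?thesis by simp
qed

lemma heis_frame_left_invariant:
  "heis_left_diff p (heis_X j q) = heis_X j (heis_mult p q)"
  "heis_left_diff p (heis_Y j q) = heis_Y j (heis_mult p q)"
  "heis_left_diff p heis_T = heis_T"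
proof -
  have *: "(\<Sum>i\<in>UNIV. z $ i * cnj (axis j c $ i)) = z $ j * cnj c" for z :: "complex ^ 'n" and j c
  proof -
    have "(\<Sum>i\<in>UNIV. z $ i * cnj (axis j c $ i)) = (\<Sum>i\<in>UNIV. if i = j then z $ j * cnj c else 0)"
      by (rule sum.cong) (auto simp: axis_def)
    then show ?thesis by simp
  qed
  show "heis_left_diff p (heis_X j q) = heis_X j (heis_mult p q)"
    "heis_left_diff p (heis_Y j q) = heis_Y j (heis_mult p q)"
    "heis_left_diff p heis_T = heis_T"
    by (simp_all add: heis_left_diff_def heis_X_def heis_Y_def heis_T_def heis_mult_def *)
qed

definition abs_continuous_curve :: "real \<Rightarrow> real \<Rightarrow> (real \<Rightarrow> 'a::metric_space) \<Rightarrow> bool" where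
  "abs_continuous_curve a b \<gamma> \<longleftrightarrow>
     (\<forall>\<epsilon>>0. \<exists>\<delta>>0. \<forall>(N::nat) u v.
        (\<forall>i<N. a \<le> u i \<and> u i \<le> v i \<and> v i \<le> b) \<and>
        disjoint_family_on (\<lambda>i. {u i<..<v i}) {..<N} \<and>
        (\<Sum>i<N. v i - u i) < \<delta>
        \<longrightarrow> (\<Sum>i<N. dist (\<gamma> (u i)) (\<gamma> (v i))) < \<epsilon>)"

text \<open>Curves are parametrized by the unit interval.\<close>

definition horizontal_curve :: "(real \<Rightarrow> 'n::finite heis) \<Rightarrow> bool" where
  "horizontal_curve \<gamma> \<longleftrightarrow>
     abs_continuous_curve 0 1 \<gamma> \<and>
     (AE s in lebesgue_on {0..1}.
        \<exists>v. (\<gamma> has_vector_derivative v) (at s) \<and> v \<in> horizontal_space (\<gamma> s))"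

text \<open>
  For absolutely continuous curves \<open>vector_derivative\<close> is the actual derivative almost everywhere
  and the integrand is Lebesgue integrable.
\<close>

definition riem_length :: "(real \<Rightarrow> 'n::finite heis) \<Rightarrow> real" where
  "riem_length \<gamma> = (LINT s|lebesgue_on {0..1}.
     sqrt (heis_metric (\<gamma> s) (vector_derivative \<gamma> (at s)) (vector_derivative \<gamma> (at s))))"

definition cc_dist :: "'n::finite heis \<Rightarrow> 'n heis \<Rightarrow> real" where
  "cc_dist p q =
     Inf {riem_length \<gamma> | \<gamma>. horizontal_curve \<gamma> \<and> pathstart \<gamma> = p \<and> pathfinish \<gamma> = q}"

definition cc_diameter :: "'n::finite heis set \<Rightarrow> real" where
  "cc_diameter E = (if E = {} then 0 else SUP (p, q)\<in>E \<times> E. cc_dist p q)"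

definition t_convex :: "'n::finite heis set \<Rightarrow> bool" where
  "t_convex F \<longleftrightarrow>
     (\<forall>z t1 t2. (z, t1) \<in> F \<and> (z, t2) \<in> F \<and> t1 \<le> t2 \<longrightarrow> (\<forall>t\<in>{t1..t2}. (z, t) \<in> F))"

definition upper_fun :: "'n::finite heis set \<Rightarrow> complex ^ 'n \<Rightarrow> real" where
  "upper_fun E z = (GREATEST t. (z, t) \<in> E)"

definition lower_fun :: "'n::finite heis set \<Rightarrow> complex ^ 'n \<Rightarrow> real" where
  "lower_fun E z = (LEAST t. (z, t) \<in> E)"

definition thick_set :: "'n::finite heis set \<Rightarrow> (complex ^ 'n) set" where
  "thick_set E = {z \<in> fst ` E. lower_fun E z < upper_fun E z}"

definition hat_set :: "'n::finite heis set \<Rightarrow> 'n heis set" where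
  "hat_set E =
     {(z, t). z \<in> closure (thick_set E) \<and> lower_fun E z \<le> t \<and> t \<le> upper_fun E z}"

definition locally_lipschitz_on ::
  "'a::metric_space set \<Rightarrow> ('a \<Rightarrow> 'b::metric_space) \<Rightarrow> bool" where
  "locally_lipschitz_on S f \<longleftrightarrow> (\<forall>x\<in>S. \<exists>r>0. \<exists>L. L-lipschitz_on (ball x r \<inter> S) f)"

end

theory Submission
  imports Defs
begin

text \<open>
  If \<open>p\<close> is a boundary point, then by (NC) it lies on the sphere of radius \<open>D = diam E\<close> about some
  \<open>q \<in> E\<close>, while \<open>E\<close> is contained in the closed ball about \<open>q\<close>.  No explicit formula for the
  distance is needed to understand the fibres of that ball.  Dilating a curve from \<open>0\<close> to \<open>[z, t]\<close>
  by \<open>s \<in> [0, 1]\<close> and appending the segment from \<open>s z\<close> to \<open>z\<close> gives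
  \<open>d(0, [z, s\<^sup>2 t]) \<le> s d(0, [z, t]) + (1 - s) |z|\<close>, and \<open>d(0, [z, t]) > |z|\<close> quantitatively when
  \<open>t \<noteq> 0\<close>, because a curve barely longer than the segment from \<open>0\<close> to \<open>z\<close> encloses little area.
  Hence a point strictly between two points of a fibre of the ball is in the open ball, and the
  same holds with the two points replaced by points in steep upward and downward cones.  Applied to
  points of \<open>E\<close>, this shows that boundary points of \<open>E\<close> on nondegenerate fibres are end points of
  their fibres and that the end points depend in a Lipschitz way on the fibre.
\<close>

section \<open>Absolutely continuous curves\<close>

text \<open>The slope of the cones must depend neither on the boundary point nor on the point
  \<open>q\<close> that (NC) supplies, about whose position nothing is known. Uniformity comes from
  the length \<eta> of the fibre: seen from any \<open>q\<close>, one of its two ends has relative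
  height at least \<open>\<eta> / 2\<close>, which keeps the horizontal distance to \<open>q\<close>
  below \<open>D\<close> by a fixed amount. This amount is what a dilation gains, and it degenerates
  with \<eta>. The Lipschitz bounds are therefore local, and continuity at one-point fibres has a
  different source: semicontinuity of the end point functions of a compact set.

  Bounding lengths from below requires recovering an absolutely continuous curve from its
  derivative. The gauge integral yields this without prior knowledge that the derivative is
  integrable; absolute integrability, and with it the link to the Lebesgue integral in
  \<open>riem_length\<close>, is derived afterwards.\<close>

lemma abs_continuous_curveD:
  fixes f :: "real \<Rightarrow> 'a::metric_space"
  assumes "abs_continuous_curve a b f" and "\<epsilon> > 0"
  obtains \<delta> where "\<delta> > 0"
    and "\<forall>(I::'i set) u v. finite I \<and> (\<forall>i\<in>I. a \<le> u i \<and> u i \<le> v i \<and> v i \<le> b) \<and>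
          disjoint_family_on (\<lambda>i. {u i<..<v i}) I \<and> (\<Sum>i\<in>I. v i - u i) < \<delta>
        \<longrightarrow> (\<Sum>i\<in>I. dist (f (u i)) (f (v i))) < \<epsilon>"
proof -
  obtain \<delta> where "\<delta> > 0" and \<delta>: "\<And>(N::nat) u v. \<lbrakk>\<forall>i<N. a \<le> u i \<and> u i \<le> v i \<and> v i \<le> b;
        disjoint_family_on (\<lambda>i. {u i<..<v i}) {..<N}; (\<Sum>i<N. v i - u i) < \<delta>\<rbrakk>
        \<Longrightarrow> (\<Sum>i<N. dist (f (u i)) (f (v i))) < \<epsilon>"
    using assms unfolding abs_continuous_curve_def by meson
  have "(\<Sum>i\<in>I. dist (f (u i)) (f (v i))) < \<epsilon>"
    if "finite I" and uv: "\<And>i. i \<in> I \<Longrightarrow> a \<le> u i \<and> u i \<le> v i \<and> v i \<le> b"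
      and disj: "disjoint_family_on (\<lambda>i. {u i<..<v i}) I" and len: "(\<Sum>i\<in>I. v i - u i) < \<delta>"
    for I :: "'i set" and u v
  proof -
    \<comment> \<open>The definition enumerates the intervals by naturals; reindexing allows the
      members of a division to serve as indices themselves.\<close>
    obtain h where h: "bij_betw h {..<card I} I"
      using ex_bij_betw_nat_finite[OF \<open>finite I\<close>] by (auto simp: atLeast0LessThan)
    have reindex: "(\<Sum>i<card I. g (h i)) = (\<Sum>i\<in>I. g i)" for g :: "'i \<Rightarrow> real"
      using sum.reindex_bij_betw[OF h] .
    have "(\<Sum>i<card I. dist (f (u (h i))) (f (v (h i)))) < \<epsilon>"
    proof (rule \<delta>)
      show "\<forall>i<card I. a \<le> u (h i) \<and> u (h i) \<le> v (h i) \<and> v (h i) \<le> b"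
        using bij_betwE[OF h] uv by blast
      show "disjoint_family_on (\<lambda>i. {u (h i)<..<v (h i)}) {..<card I}"
        using disj h unfolding disjoint_family_on_def bij_betw_def inj_on_def by blast
      show "(\<Sum>i<card I. v (h i) - u (h i)) < \<delta>"
        using len reindex[of "\<lambda>i. v i - u i"] by simp
    qed
    then show ?thesis
      using reindex[of "\<lambda>i. dist (f (u i)) (f (v i))"] by simp
  qed
  then show thesis
    by (intro that[OF \<open>\<delta> > 0\<close>] allI impI) auto
qed

lemma negligible_outer_open:
  fixes N :: "'a::euclidean_space set"
  assumes "negligible N" and "e > 0"
  obtains T where "open T" "N \<subseteq> T" "T \<in> lmeasurable" "measure lebesgue T < e"
proof -
  have "N \<in> sets lebesgue"
    using assms(1) by (auto simp: negligible_iff_null_sets null_sets_def)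
  then obtain T where T: "open T" "N \<subseteq> T" "T - N \<in> lmeasurable" "emeasure lebesgue (T - N) < ennreal e"
    by (rule sets_lebesgue_outer_open[OF _ \<open>e > 0\<close>])
  have "sym_diff (T - N) T = N" using T(2) by blast
  then have neg: "negligible (sym_diff (T - N) T)" using assms(1) by simp
  have "measure lebesgue (T - N) < e"
    using T(3,4) \<open>e > 0\<close> by (simp add: emeasure_eq_measure2 ennreal_less_iff)
  then show thesis
    using that[OF T(1,2)] lmeasurable_negligible_symdiff[OF T(3) neg] measure_negligible_symdiff[OF T(3) neg]
    by simp
qed

lemma sum_length_le_measure:
  fixes u v :: "'i \<Rightarrow> real"
  assumes "finite I" and "\<And>i. i \<in> I \<Longrightarrow> u i \<le> v i"
    and "disjoint_family_on (\<lambda>i. {u i<..<v i}) I"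
    and "T \<in> lmeasurable" and "\<And>i. i \<in> I \<Longrightarrow> {u i<..<v i} \<subseteq> T"
  shows "(\<Sum>i\<in>I. v i - u i) \<le> measure lebesgue T"
proof -
  have "(\<Sum>i\<in>I. v i - u i) = (\<Sum>i\<in>I. measure lebesgue {u i<..<v i})"
    using assms(2) by (intro sum.cong) (auto simp: measure_lborel_Ioo)
  also have "\<dots> = measure lebesgue (\<Union>i\<in>I. {u i<..<v i})"
    using assms(1,3) by (intro measure_finite_Union[symmetric])
      (auto simp: emeasure_lborel_Ioo assms(2))
  also have "\<dots> \<le> measure lebesgue T"
    using assms by (intro measure_mono_fmeasurable) auto
  finally show ?thesis .
qed

lemma tagged_division_interval:
  assumes "p tagged_division_of {a..b::real}" and "(x, k) \<in> p"
  obtains u v where "k = {u..v}" "a \<le> u" "u \<le> x" "x \<le> v" "v \<le> b" "Inf k = u" "Sup k = v"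
proof -
  obtain u v where uv: "k = cbox u v" using tagged_division_ofD(4)[OF assms] by blast
  moreover have "x \<in> k" "k \<subseteq> {a..b}" using tagged_division_ofD(2,3)[OF assms] by auto
  ultimately show thesis by (intro that[of u v]) auto
qed

lemma tagged_division_disjoint:
  assumes "p tagged_division_of {a..b::real}"
  shows "disjoint_family_on (\<lambda>(x, k). {Inf k<..<Sup k}) p"
  unfolding disjoint_family_on_def
proof (intro ballI impI)
  fix i j assume ij: "i \<in> p" "j \<in> p" "i \<noteq> j"
  obtain x k where i: "i = (x, k)" by (cases i)
  obtain y l where j: "j = (y, l)" by (cases j)
  obtain u v where k: "k = {u..v}" "Inf k = u" "Sup k = v"
    by (rule tagged_division_interval[OF assms ij(1)[unfolded i]])
  obtain u' v' where l: "l = {u'..v'}" "Inf l = u'" "Sup l = v'"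
    by (rule tagged_division_interval[OF assms ij(2)[unfolded j]])
  have "interior k \<inter> interior l = {}"
    using tagged_division_ofD(5)[OF assms ij(1)[unfolded i] ij(2)[unfolded j]] ij(3) i j by simp
  then show "(case i of (x, k) \<Rightarrow> {Inf k<..<Sup k}) \<inter> (case j of (x, k) \<Rightarrow> {Inf k<..<Sup k}) = {}"
    unfolding i j using k l by simp
qed

text \<open>The gauge treats the two kinds of tags differently. At a tag outside \<open>N\<close>,
  differentiability makes the increment of \<open>f\<close> agree with \<open>g\<close> times the
  length up to \<open>e / 2\<close> per unit length. The intervals tagged in \<open>N\<close> lie in
  an open set of measure below \<delta>, so absolute continuity bounds the sum of their increments
  by the other half of the error.\<close>

proposition abs_continuous_has_integral_derivative:
  fixes f :: "real \<Rightarrow> 'a::euclidean_space"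
  assumes "a \<le> b" and ac: "abs_continuous_curve a b f" and N: "negligible N"
    and deriv: "\<And>x. x \<in> {a..b} - N \<Longrightarrow> (f has_vector_derivative g x) (at x)"
  shows "(g has_integral (f b - f a)) {a..b}"
proof (cases "a = b")
  case False
  then have "a < b" using \<open>a \<le> b\<close> by simp
  \<comment> \<open>Nothing is known about \<open>g\<close> on \<open>N\<close>; with the value 0 a
    tag in \<open>N\<close> contributes only an increment of \<open>f\<close>.\<close>
  define g' where "g' x = (if x \<in> N then 0 else g x)" for x
  have "(g' has_integral (f b - f a)) {a..b}"
    unfolding has_integral_factor_content_real
  proof (intro allI impI)
    fix e :: real assume "e > 0"
    then have "e / 2 * (b - a) > 0" using \<open>a < b\<close> by simp
    then obtain \<delta> where "\<delta> > 0" and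
      \<delta>: "\<forall>(I::(real \<times> real set) set) u v.
        finite I \<and> (\<forall>i\<in>I. a \<le> u i \<and> u i \<le> v i \<and> v i \<le> b) \<and>
          disjoint_family_on (\<lambda>i. {u i<..<v i}) I \<and> (\<Sum>i\<in>I. v i - u i) < \<delta>
        \<longrightarrow> (\<Sum>i\<in>I. dist (f (u i)) (f (v i))) < e / 2 * (b - a)"
      by (rule abs_continuous_curveD[OF ac])
    obtain T where T: "open T" "N \<subseteq> T" "T \<in> lmeasurable" "measure lebesgue T < \<delta>"
      by (rule negligible_outer_open[OF N \<open>\<delta> > 0\<close>])
    let ?P = "\<lambda>x r. r > 0 \<and> (\<forall>y. \<bar>y - x\<bar> < r \<longrightarrow> norm (f y - f x - (y - x) *\<^sub>R g x) \<le> e / 2 * \<bar>y - x\<bar>)"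
    define r where "r x = (SOME r. ?P x r)" for x
    have r: "?P x (r x)" if "x \<in> {a..b} - N" for x
    proof -
      have "\<forall>e>0. \<exists>r>0. \<forall>y. \<bar>y - x\<bar> < r \<longrightarrow> norm (f y - f x - (y - x) *\<^sub>R g x) \<le> e * \<bar>y - x\<bar>"
        using deriv[OF that] unfolding has_vector_derivative_def has_derivative_at_alt by simp
      then have "\<exists>r. ?P x r" using \<open>e > 0\<close> half_gt_zero by blast
      then show ?thesis unfolding r_def by (rule someI_ex)
    qed
    \<comment> \<open>The value \<open>UNIV\<close> is a dummy: no tag lies outside
      \<open>{a..b}\<close>.\<close>
    define d where "d x = (if x \<in> N then T else if x \<in> {a..b} then ball x (r x) else UNIV)" for x
    have gauge: "gauge d"
      using T(1,2) r by (auto simp: gauge_def d_def)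
    have bound: "norm ((\<Sum>(x, k)\<in>p. measure lborel k *\<^sub>R g' x) - (f b - f a)) \<le> e * measure lborel {a..b}"
      if p: "p tagged_division_of {a..b}" and fine: "d fine p" for p
    proof -
      have fin: "finite p" using p by blast
      have fineD: "k \<subseteq> d x" if "(x, k) \<in> p" for x k using fine that by (auto simp: fine_def)
      define F :: "real \<times> real set \<Rightarrow> 'a" where "F = (\<lambda>(x, k). f (Sup k) - f (Inf k))"
      define q where "q = {(x, k) \<in> p. x \<in> N}"
      have "q \<subseteq> p" by (auto simp: q_def)
      then have finq: "finite q" using fin finite_subset by blast
      have bounds: "a \<le> Inf (snd i) \<and> Inf (snd i) \<le> Sup (snd i) \<and> Sup (snd i) \<le> b"
        if "i \<in> p" for i
        using that by (cases i, simp, elim tagged_division_interval[OF p]) auto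
      have disj: "disjoint_family_on (\<lambda>i. {Inf (snd i)<..<Sup (snd i)}) q"
        using tagged_division_disjoint[OF p] disjoint_family_on_mono[OF \<open>q \<subseteq> p\<close>]
        by (simp add: case_prod_beta')
      have "(\<Sum>i\<in>q. Sup (snd i) - Inf (snd i)) \<le> measure lebesgue T"
      proof (rule sum_length_le_measure[OF finq _ disj T(3)])
        fix i assume "i \<in> q"
        then obtain x k where i: "i = (x, k)" "(x, k) \<in> p" "x \<in> N" by (auto simp: q_def)
        then have "k \<subseteq> T" using fineD[OF i(2)] by (simp add: d_def)
        moreover have "{Inf k<..<Sup k} \<subseteq> k"
          by (rule tagged_division_interval[OF p i(2)]) auto
        ultimately show "{Inf (snd i)<..<Sup (snd i)} \<subseteq> T" using i by auto
        show "Inf (snd i) \<le> Sup (snd i)" using bounds i by auto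
      qed
      then have "(\<Sum>i\<in>q. dist (f (Inf (snd i))) (f (Sup (snd i)))) < e / 2 * (b - a)"
        using bounds \<open>q \<subseteq> p\<close> T(4) finq disj
        by (intro \<delta>[rule_format]) auto
      moreover have "norm (measure lborel k *\<^sub>R g' x - F (x, k)) = dist (f (Inf k)) (f (Sup k))"
        if "(x, k) \<in> q" for x k
        using that by (simp add: q_def g'_def F_def dist_norm)
      moreover from this have "(\<Sum>(x, k)\<in>q. norm (measure lborel k *\<^sub>R g' x - F (x, k)))
          = (\<Sum>i\<in>q. dist (f (Inf (snd i))) (f (Sup (snd i))))"
        by (intro sum.cong) auto
      ultimately have sum_q: "(\<Sum>(x, k)\<in>q. norm (measure lborel k *\<^sub>R g' x - F (x, k))) \<le> e / 2 * (b - a)"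
        by simp
      have "norm (measure lborel k *\<^sub>R g' x - F (x, k)) \<le> e / 2 * measure lborel k" if "(x, k) \<in> p - q" for x k
      proof -
        have xk: "(x, k) \<in> p" and "x \<notin> N" using that by (auto simp: q_def)
        obtain u v where uv: "k = {u..v}" "a \<le> u" "u \<le> x" "x \<le> v" "v \<le> b" "Inf k = u" "Sup k = v"
          using tagged_division_interval[OF p xk] .
        have x: "x \<in> {a..b} - N" using uv \<open>x \<notin> N\<close> by auto
        have "k \<subseteq> ball x (r x)" using fineD[OF xk] x by (simp add: d_def)
        then have "\<bar>u - x\<bar> < r x" "\<bar>v - x\<bar> < r x"
          using uv subsetD[of k "ball x (r x)" u] subsetD[of k "ball x (r x)" v]
          by (auto simp: dist_real_def abs_minus_commute)
        then have "norm (f u - f x - (u - x) *\<^sub>R g x) \<le> e / 2 * \<bar>u - x\<bar>"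
          "norm (f v - f x - (v - x) *\<^sub>R g x) \<le> e / 2 * \<bar>v - x\<bar>"
          using r[OF x] by auto
        \<comment> \<open>Straddle estimate: the increment is split at the tag. As the tag lies in
          the interval, the two error terms add up to the length of \<open>k\<close>.\<close>
        moreover have "measure lborel k *\<^sub>R g' x - F (x, k)
            = (f u - f x - (u - x) *\<^sub>R g x) - (f v - f x - (v - x) *\<^sub>R g x)"
          using uv \<open>x \<notin> N\<close> by (simp add: g'_def F_def algebra_simps)
        ultimately have "norm (measure lborel k *\<^sub>R g' x - F (x, k)) \<le> e / 2 * \<bar>u - x\<bar> + e / 2 * \<bar>v - x\<bar>"
          by (simp only: order_trans[OF norm_triangle_ineq4 add_mono])
        also have "\<dots> = e / 2 * (\<bar>u - x\<bar> + \<bar>v - x\<bar>)" by (rule distrib_left[symmetric])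
        also have "\<bar>u - x\<bar> + \<bar>v - x\<bar> = measure lborel k" using uv by simp
        finally show ?thesis .
      qed
      then have "(\<Sum>(x, k)\<in>p - q. norm (measure lborel k *\<^sub>R g' x - F (x, k))) \<le> (\<Sum>(x, k)\<in>p - q. e / 2 * measure lborel k)"
        by (intro sum_mono) auto
      also have "\<dots> \<le> (\<Sum>(x, k)\<in>p. e / 2 * measure lborel k)"
        using fin \<open>e > 0\<close> by (intro sum_mono2) auto
      also have "\<dots> = e / 2 * (\<Sum>(x, k)\<in>p. measure lborel k)"
        by (simp only: case_prod_beta' sum_distrib_left)
      also have "(\<Sum>(x, k)\<in>p. measure lborel k) = b - a"
        using additive_content_tagged_division[of p a b] p \<open>a \<le> b\<close> by simp
      finally have sum_pq: "(\<Sum>(x, k)\<in>p - q. norm (measure lborel k *\<^sub>R g' x - F (x, k))) \<le> e / 2 * (b - a)" .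
      have "(\<Sum>(x, k)\<in>p. measure lborel k *\<^sub>R g' x) - (f b - f a)
          = (\<Sum>(x, k)\<in>p. measure lborel k *\<^sub>R g' x - F (x, k))"
        using additive_tagged_division_1[OF \<open>a \<le> b\<close> p, of f]
        by (simp add: F_def sum_subtractf case_prod_beta')
      also have "norm \<dots> \<le> (\<Sum>(x, k)\<in>p. norm (measure lborel k *\<^sub>R g' x - F (x, k)))"
        by (rule order_trans[OF norm_sum]) (simp add: case_prod_beta')
      also have "\<dots> = (\<Sum>(x, k)\<in>p - q. norm (measure lborel k *\<^sub>R g' x - F (x, k)))
          + (\<Sum>(x, k)\<in>q. norm (measure lborel k *\<^sub>R g' x - F (x, k)))"
        by (rule sum.subset_diff[OF \<open>q \<subseteq> p\<close> fin])
      also have "\<dots> \<le> e * measure lborel {a..b}" using sum_q sum_pq \<open>a \<le> b\<close> by simp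
      finally show ?thesis .
    qed
    show "\<exists>d. gauge d \<and> (\<forall>p. p tagged_division_of {a..b} \<and> d fine p \<longrightarrow>
        norm ((\<Sum>(x, k)\<in>p. measure lborel k *\<^sub>R g' x) - (f b - f a)) \<le> e * measure lborel {a..b})"
      by (intro exI[of _ d] conjI allI impI gauge bound) (erule conjunct1, erule conjunct2)
  qed
  then show ?thesis
    by (rule has_integral_spike[OF N, rotated]) (simp add: g'_def)
qed auto

lemma abs_continuous_curve_subset:
  assumes "abs_continuous_curve a b f" and "a \<le> c" and "d \<le> b"
  shows "abs_continuous_curve c d f"
  unfolding abs_continuous_curve_def
proof (intro allI impI)
  fix \<epsilon> :: real assume "\<epsilon> > 0"
  then obtain \<delta> where \<delta>: "\<delta> > 0"
    "\<forall>(N::nat) u v. (\<forall>i<N. a \<le> u i \<and> u i \<le> v i \<and> v i \<le> b) \<and>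
        disjoint_family_on (\<lambda>i. {u i<..<v i}) {..<N} \<and> (\<Sum>i<N. v i - u i) < \<delta>
        \<longrightarrow> (\<Sum>i<N. dist (f (u i)) (f (v i))) < \<epsilon>"
    using assms(1) unfolding abs_continuous_curve_def by meson
  show "\<exists>\<delta>>0. \<forall>(N::nat) u v. (\<forall>i<N. c \<le> u i \<and> u i \<le> v i \<and> v i \<le> d) \<and>
        disjoint_family_on (\<lambda>i. {u i<..<v i}) {..<N} \<and> (\<Sum>i<N. v i - u i) < \<delta>
        \<longrightarrow> (\<Sum>i<N. dist (f (u i)) (f (v i))) < \<epsilon>"
  proof (intro exI[of _ \<delta>] conjI allI impI \<delta>(1))
    fix N :: nat and u v :: "nat \<Rightarrow> real"
    assume uv: "(\<forall>i<N. c \<le> u i \<and> u i \<le> v i \<and> v i \<le> d) \<and>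
        disjoint_family_on (\<lambda>i. {u i<..<v i}) {..<N} \<and> (\<Sum>i<N. v i - u i) < \<delta>"
    then have "\<forall>i<N. a \<le> u i \<and> u i \<le> v i \<and> v i \<le> b"
      using assms(2,3) by force
    with uv show "(\<Sum>i<N. dist (f (u i)) (f (v i))) < \<epsilon>"
      using \<delta>(2) by blast
  qed
qed

text \<open>Monotonicity keeps the images of disjoint intervals disjoint, and the Lipschitz bound
  keeps their total length small. Constant stretches of \<open>\<phi>\<close> are allowed;
  concatenation uses them to let a curve rest at an end point.\<close>

lemma abs_continuous_curve_reparam:
  assumes ac: "abs_continuous_curve c d f" and "K > 0"
    and mono: "\<And>s t. \<lbrakk>a \<le> s; s \<le> t; t \<le> b\<rbrakk> \<Longrightarrow> \<phi> s \<le> \<phi> t \<and> \<phi> t - \<phi> s \<le> K * (t - s)"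
    and range: "\<And>s. \<lbrakk>a \<le> s; s \<le> b\<rbrakk> \<Longrightarrow> c \<le> \<phi> s \<and> \<phi> s \<le> d"
  shows "abs_continuous_curve a b (\<lambda>s. f (\<phi> s))"
  unfolding abs_continuous_curve_def
proof (intro allI impI)
  fix \<epsilon> :: real assume "\<epsilon> > 0"
  then obtain \<delta> where \<delta>: "\<delta> > 0"
    "\<forall>(N::nat) u v. (\<forall>i<N. c \<le> u i \<and> u i \<le> v i \<and> v i \<le> d) \<and>
        disjoint_family_on (\<lambda>i. {u i<..<v i}) {..<N} \<and> (\<Sum>i<N. v i - u i) < \<delta>
        \<longrightarrow> (\<Sum>i<N. dist (f (u i)) (f (v i))) < \<epsilon>"
    using ac unfolding abs_continuous_curve_def by meson
  show "\<exists>\<delta>>0. \<forall>(N::nat) u v. (\<forall>i<N. a \<le> u i \<and> u i \<le> v i \<and> v i \<le> b) \<and>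
        disjoint_family_on (\<lambda>i. {u i<..<v i}) {..<N} \<and> (\<Sum>i<N. v i - u i) < \<delta>
        \<longrightarrow> (\<Sum>i<N. dist (f (\<phi> (u i))) (f (\<phi> (v i)))) < \<epsilon>"
  proof (intro exI[of _ "\<delta> / K"] conjI allI impI)
    show "\<delta> / K > 0" using \<delta>(1) \<open>K > 0\<close> by simp
    fix N :: nat and u v :: "nat \<Rightarrow> real"
    assume *: "(\<forall>i<N. a \<le> u i \<and> u i \<le> v i \<and> v i \<le> b) \<and>
        disjoint_family_on (\<lambda>i. {u i<..<v i}) {..<N} \<and> (\<Sum>i<N. v i - u i) < \<delta> / K"
    then have uv: "a \<le> u i" "u i \<le> v i" "v i \<le> b" if "i < N" for i using that by auto
    have "\<forall>i<N. c \<le> \<phi> (u i) \<and> \<phi> (u i) \<le> \<phi> (v i) \<and> \<phi> (v i) \<le> d"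
      using uv mono range by (meson order_trans)
    moreover have "disjoint_family_on (\<lambda>i. {\<phi> (u i)<..<\<phi> (v i)}) {..<N}"
      unfolding disjoint_family_on_def
    proof (intro ballI impI)
      fix i j assume ij: "i \<in> {..<N}" "j \<in> {..<N}" "i \<noteq> j"
      then have "{u i<..<v i} \<inter> {u j<..<v j} = {}"
        using * unfolding disjoint_family_on_def by blast
      then have "max (u i) (u j) \<ge> min (v i) (v j)"
        using dense[of "max (u i) (u j)" "min (v i) (v j)"] by (auto simp: disjoint_iff not_le)
      \<comment> \<open>Disjoint open intervals are ordered unless one of them is empty, and an
        empty one has an empty image.\<close>
      then have "v i \<le> u j \<or> v j \<le> u i \<or> u i = v i \<or> u j = v j"
        using uv[of i] uv[of j] ij by (auto simp: max_def min_def split: if_splits)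
      then have "\<phi> (v i) \<le> \<phi> (u j) \<or> \<phi> (v j) \<le> \<phi> (u i) \<or> u i = v i \<or> u j = v j"
        using uv[of i] uv[of j] ij mono by auto
      then show "{\<phi> (u i)<..<\<phi> (v i)} \<inter> {\<phi> (u j)<..<\<phi> (v j)} = {}" by auto
    qed
    moreover have "(\<Sum>i<N. \<phi> (v i) - \<phi> (u i)) < \<delta>"
    proof -
      have "(\<Sum>i<N. \<phi> (v i) - \<phi> (u i)) \<le> (\<Sum>i<N. K * (v i - u i))"
        using uv mono by (intro sum_mono) auto
      also have "\<dots> = K * (\<Sum>i<N. v i - u i)" by (simp only: sum_distrib_left)
      also have "\<dots> < \<delta>" using * \<open>K > 0\<close> by (simp add: pos_less_divide_eq mult.commute)
      finally show ?thesis .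
    qed
    ultimately show "(\<Sum>i<N. dist (f (\<phi> (u i))) (f (\<phi> (v i)))) < \<epsilon>"
      using \<delta>(2)[rule_format, of N "\<lambda>i. \<phi> (u i)" "\<lambda>i. \<phi> (v i)"] by blast
  qed
qed

text \<open>The form with two dominating curves serves concatenation, where an increment may
  straddle the junction; Lipschitz images are the case \<open>f = g\<close>.\<close>

lemma abs_continuous_curve_dominated:
  assumes f: "abs_continuous_curve a b f" and g: "abs_continuous_curve a b g" and "K > 0"
    and dom: "\<And>s t. \<lbrakk>a \<le> s; s \<le> t; t \<le> b\<rbrakk>
      \<Longrightarrow> dist (h s) (h t) \<le> K * (dist (f s) (f t) + dist (g s) (g t))"
  shows "abs_continuous_curve a b h"
  unfolding abs_continuous_curve_def
proof (intro allI impI)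
  fix \<epsilon> :: real assume "\<epsilon> > 0"
  then have e2: "\<epsilon> / (2 * K) > 0" using \<open>K > 0\<close> by simp
  obtain \<delta>1 where \<delta>1: "\<delta>1 > 0"
    "\<forall>(N::nat) u v. (\<forall>i<N. a \<le> u i \<and> u i \<le> v i \<and> v i \<le> b) \<and>
        disjoint_family_on (\<lambda>i. {u i<..<v i}) {..<N} \<and> (\<Sum>i<N. v i - u i) < \<delta>1
        \<longrightarrow> (\<Sum>i<N. dist (f (u i)) (f (v i))) < \<epsilon> / (2 * K)"
    using f e2 unfolding abs_continuous_curve_def by meson
  obtain \<delta>2 where \<delta>2: "\<delta>2 > 0"
    "\<forall>(N::nat) u v. (\<forall>i<N. a \<le> u i \<and> u i \<le> v i \<and> v i \<le> b) \<and>
        disjoint_family_on (\<lambda>i. {u i<..<v i}) {..<N} \<and> (\<Sum>i<N. v i - u i) < \<delta>2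
        \<longrightarrow> (\<Sum>i<N. dist (g (u i)) (g (v i))) < \<epsilon> / (2 * K)"
    using g e2 unfolding abs_continuous_curve_def by meson
  show "\<exists>\<delta>>0. \<forall>(N::nat) u v. (\<forall>i<N. a \<le> u i \<and> u i \<le> v i \<and> v i \<le> b) \<and>
        disjoint_family_on (\<lambda>i. {u i<..<v i}) {..<N} \<and> (\<Sum>i<N. v i - u i) < \<delta>
        \<longrightarrow> (\<Sum>i<N. dist (h (u i)) (h (v i))) < \<epsilon>"
  proof (intro exI[of _ "min \<delta>1 \<delta>2"] conjI allI impI)
    show "min \<delta>1 \<delta>2 > 0" using \<delta>1(1) \<delta>2(1) by simp
    fix N :: nat and u v :: "nat \<Rightarrow> real"
    assume *: "(\<forall>i<N. a \<le> u i \<and> u i \<le> v i \<and> v i \<le> b) \<and>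
        disjoint_family_on (\<lambda>i. {u i<..<v i}) {..<N} \<and> (\<Sum>i<N. v i - u i) < min \<delta>1 \<delta>2"
    have "(\<Sum>i<N. dist (h (u i)) (h (v i)))
        \<le> (\<Sum>i<N. K * (dist (f (u i)) (f (v i)) + dist (g (u i)) (g (v i))))"
      using * dom by (intro sum_mono) auto
    also have "\<dots> = K * ((\<Sum>i<N. dist (f (u i)) (f (v i))) + (\<Sum>i<N. dist (g (u i)) (g (v i))))"
      by (simp add: sum.distrib flip: sum_distrib_left)
    also have "\<dots> < K * (\<epsilon> / (2 * K) + \<epsilon> / (2 * K))"
      using * \<delta>1(2)[rule_format, of N u v] \<delta>2(2)[rule_format, of N u v] \<open>K > 0\<close>
      by (intro mult_strict_left_mono add_strict_mono) auto
    also have "\<dots> = \<epsilon>" using \<open>K > 0\<close> by (simp add: field_simps)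
    finally show "(\<Sum>i<N. dist (h (u i)) (h (v i))) < \<epsilon>" .
  qed
qed

lemma abs_continuous_curve_ident: "abs_continuous_curve a b (\<lambda>s::real. s)"
  unfolding abs_continuous_curve_def
proof (intro allI impI)
  fix \<epsilon> :: real assume "\<epsilon> > 0"
  moreover have "(\<Sum>i<N. dist (u i) (v i)) = (\<Sum>i<N. v i - u i)"
    if "\<forall>i<N. a \<le> u i \<and> u i \<le> v i \<and> v i \<le> b" for N :: nat and u v :: "nat \<Rightarrow> real"
    using that by (intro sum.cong) (auto simp: dist_real_def)
  ultimately show "\<exists>\<delta>>0. \<forall>(N::nat) u v. (\<forall>i<N. a \<le> u i \<and> u i \<le> v i \<and> v i \<le> b) \<and>
        disjoint_family_on (\<lambda>i. {u i<..<v i}) {..<N} \<and> (\<Sum>i<N. v i - u i) < \<delta>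
        \<longrightarrow> (\<Sum>i<N. dist (u i) (v i)) < \<epsilon>"
    by (intro exI[of _ \<epsilon>]) simp
qed

lemma abs_continuous_curve_lipschitz_compose:
  assumes "abs_continuous_curve a b f" and "K > 0" and "\<And>x y. dist (h x) (h y) \<le> K * dist x y"
  shows "abs_continuous_curve a b (\<lambda>s. h (f s))"
proof (rule abs_continuous_curve_dominated[OF assms(1,1,2)])
  fix s t
  have "dist (h (f s)) (h (f t)) \<le> K * dist (f s) (f t)" by (rule assms(3))
  also have "\<dots> \<le> K * (dist (f s) (f t) + dist (f s) (f t))"
    using \<open>K > 0\<close> by (intro mult_left_mono) auto
  finally show "dist (h (f s)) (h (f t)) \<le> K * (dist (f s) (f t) + dist (f s) (f t))" .
qed

text \<open>Absolute continuity with error 1 bounds the variation of \<open>f\<close>, hence that of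
  the indefinite integral of \<open>g\<close>, by 1 on every interval shorter than \<delta>.
  Finitely many such intervals cover \<open>{a..b}\<close>.\<close>

proposition abs_continuous_absolutely_integrable_derivative:
  fixes f :: "real \<Rightarrow> 'a::euclidean_space"
  assumes "a \<le> b" and ac: "abs_continuous_curve a b f" and N: "negligible N"
    and deriv: "\<And>x. x \<in> {a..b} - N \<Longrightarrow> (f has_vector_derivative g x) (at x)"
  shows "g absolutely_integrable_on {a..b}"
proof -
  have FTC: "(g has_integral (f v - f u)) {u..v}" if "a \<le> u" "u \<le> v" "v \<le> b" for u v
    using that
    by (intro abs_continuous_has_integral_derivative[OF _ abs_continuous_curve_subset[OF ac] N] deriv) auto
  obtain \<delta> where "\<delta> > 0" and
      \<delta>: "\<forall>(I::(real set) set) u v.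
        finite I \<and> (\<forall>i\<in>I. a \<le> u i \<and> u i \<le> v i \<and> v i \<le> b) \<and>
          disjoint_family_on (\<lambda>i. {u i<..<v i}) I \<and> (\<Sum>i\<in>I. v i - u i) < \<delta>
        \<longrightarrow> (\<Sum>i\<in>I. dist (f (u i)) (f (v i))) < 1"
    by (rule abs_continuous_curveD[OF ac zero_less_one])
  have short: "g absolutely_integrable_on {c..d}" if cd: "a \<le> c" "c \<le> d" "d \<le> b" "d - c < \<delta>" for c d
    unfolding interval_cbox
  proof (rule bounded_variation_absolutely_integrable_interval[where B = 1])
    show "g integrable_on cbox c d" using FTC[OF cd(1-3)] by auto
    fix D assume D: "D division_of cbox c d"
    have K: "\<exists>u v. K = {u..v} \<and> c \<le> u \<and> u \<le> v \<and> v \<le> d \<and> Inf K = u \<and> Sup K = v" if K: "K \<in> D" for K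
    proof -
      obtain u v where uv: "K = cbox u v" using division_ofD(4)[OF D K] by blast
      moreover have "K \<noteq> {}" "K \<subseteq> cbox c d" using division_ofD(2,3)[OF D K] by auto
      ultimately show ?thesis by (intro exI[of _ u] exI[of _ v]) auto
    qed
    have "(\<Sum>K\<in>D. dist (f (Inf K)) (f (Sup K))) < 1"
    proof (rule \<delta>[rule_format], intro conjI ballI)
      show "finite D" using D by blast
      show "a \<le> Inf K" "Inf K \<le> Sup K" "Sup K \<le> b" if "K \<in> D" for K
        using K[OF that] cd by auto
      show "disjoint_family_on (\<lambda>K. {Inf K<..<Sup K}) D"
        unfolding disjoint_family_on_def
      proof (intro ballI impI)
        fix K L assume KL: "K \<in> D" "L \<in> D" "K \<noteq> L"
        then have "interior K \<inter> interior L = {}" using division_ofD(5)[OF D] by blast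
        then show "{Inf K<..<Sup K} \<inter> {Inf L<..<Sup L} = {}"
          using K[OF KL(1)] K[OF KL(2)]
          by (metis interior_atLeastAtMost_real)
      qed
      have "(\<Sum>K\<in>D. Sup K - Inf K) = (\<Sum>K\<in>D. measure lborel K)"
      proof (rule sum.cong)
        fix K assume "K \<in> D"
        then show "Sup K - Inf K = measure lborel K"
          using K[of K] by (metis measure_lborel_Icc)
      qed simp
      also have "\<dots> = d - c" using additive_content_division[OF D] cd by simp
      finally show "(\<Sum>K\<in>D. Sup K - Inf K) < \<delta>" using cd by simp
    qed
    moreover have "norm (integral K g) = dist (f (Inf K)) (f (Sup K))" if "K \<in> D" for K
    proof -
      obtain u v where "K = {u..v}" "c \<le> u" "u \<le> v" "v \<le> d" "Inf K = u" "Sup K = v"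
        using K[OF \<open>K \<in> D\<close>] by blast
      then show ?thesis using FTC[of u v] cd by (simp add: integral_unique dist_norm norm_minus_commute)
    qed
    ultimately show "(\<Sum>K\<in>D. norm (integral K g)) \<le> 1" by simp
  qed
  \<comment> \<open>Steps of \<open>\<delta> / 2\<close> stay strictly below \<delta>; the minimum
    with \<open>b\<close> stops the induction at the right end.\<close>
  have "g absolutely_integrable_on {a..min b (a + real n * (\<delta> / 2))}" for n
  proof (induction n)
    case 0
    then show ?case using \<open>a \<le> b\<close> short[of a a] \<open>\<delta> > 0\<close> by simp
  next
    case (Suc n)
    let ?c = "min b (a + real n * (\<delta> / 2))" and ?d = "min b (a + real (Suc n) * (\<delta> / 2))"
    have "real (Suc n) * (\<delta> / 2) = real n * (\<delta> / 2) + \<delta> / 2" "real n * (\<delta> / 2) \<ge> 0"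
      using \<open>\<delta> > 0\<close> by (simp_all add: algebra_simps add_divide_distrib)
    then have "a \<le> ?c" "?c \<le> ?d" "?d \<le> b" "?d - ?c < \<delta>"
      using \<open>a \<le> b\<close> \<open>\<delta> > 0\<close> by linarith+
    then show ?case
      using absolutely_integrable_on_combine[OF Suc short[of ?c ?d]] by blast
  qed
  moreover obtain n where "(b - a) / (\<delta> / 2) < real n" using reals_Archimedean2 by blast
  ultimately show ?thesis
    using \<open>\<delta> > 0\<close> by (metis (no_types, opaque_lifting) add.commute diff_less_eq half_gt_zero min.absorb1 order_less_imp_le pos_divide_less_eq)
qed

section \<open>Horizontal curves\<close>

lemma sum_heis_coeff:
  fixes v w :: "complex ^ 'n::finite"
  shows "(\<Sum>j\<in>UNIV. Re (v $ j) * (2 * Im (w $ j)) + Im (v $ j) * (- 2 * Re (w $ j)))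
    = 2 * Im (\<Sum>j\<in>UNIV. w $ j * cnj (v $ j))"
  by (simp add: sum_distrib_left algebra_simps)

text \<open>Up to sign the standard symplectic form; twice this form is the vertical term of the
  group law. Its vanishing on parallel vectors is what makes segments from the origin
  horizontal.\<close>

definition symp :: "complex ^ 'n::finite \<Rightarrow> complex ^ 'n \<Rightarrow> real" where
  "symp v w = Im (\<Sum>j\<in>UNIV. v $ j * cnj (w $ j))"

lemma bounded_bilinear_symp: "bounded_bilinear (symp :: complex ^ 'n::finite \<Rightarrow> _)"
proof -
  have "linear (symp v)" for v :: "complex ^ 'n"
    by (rule linearI)
      (simp_all add: symp_def distrib_left sum.distrib mult.left_commute flip: sum_distrib_left)
  moreover have "linear (\<lambda>v. symp v w)" for w :: "complex ^ 'n"
    by (rule linearI)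
      (simp_all add: symp_def distrib_right sum.distrib mult.assoc flip: sum_distrib_left)
  ultimately show ?thesis
    by (simp add: bilinear_conv_bounded_bilinear[symmetric] bilinear_def)
qed

lemma symp_commute: "symp v w = - symp w v"
  by (simp add: symp_def mult.commute flip: sum_negf)

lemma symp_self [simp]: "symp v v = 0"
  using symp_commute[of v v] by simp

interpretation symp: bounded_bilinear "symp :: complex ^ 'n::finite \<Rightarrow> _"
  by (rule bounded_bilinear_symp)

lemma heis_mult_symp: "heis_mult p q = (fst p + fst q, snd p + snd q + 2 * symp (fst p) (fst q))"
  by (simp add: heis_mult_def symp_def)

lemma vertical_coeff_symp: "vertical_coeff p v = snd v - 2 * symp (fst p) (fst v)"
  unfolding vertical_coeff_def symp_def sum_heis_coeff ..

text \<open>\<open>vertical_coeff p\<close> is the contact form at \<open>p\<close>. Passing to its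
  kernel turns membership in a span into one scalar equation.\<close>

lemma horizontal_space_iff: "v \<in> horizontal_space p \<longleftrightarrow> vertical_coeff p v = 0"
proof
  assume "v \<in> horizontal_space p"
  then show "vertical_coeff p v = 0"
    unfolding horizontal_space_def
    by (induction rule: span_induct_alt)
      (auto simp: linear_0[OF linear_vertical_coeff] linear_add[OF linear_vertical_coeff]
        linear_cmul[OF linear_vertical_coeff])
next
  assume "vertical_coeff p v = 0"
  then show "v \<in> horizontal_space p"
    unfolding horizontal_space_def
    by (subst heis_frame_expand[of v p])
      (auto intro!: span_add span_sum span_scale intro: span_base)
qed

lemma AE_lebesgue_on_negligible:
  assumes "S \<in> sets lebesgue"
  shows "(AE s in lebesgue_on S. P s) \<longleftrightarrow> (\<exists>N. negligible N \<and> (\<forall>s\<in>S - N. P s))"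
proof
  assume "AE s in lebesgue_on S. P s"
  then have "AE s in lebesgue. s \<in> S \<longrightarrow> P s"
    using assms by (simp add: AE_restrict_space_iff)
  then obtain N where "N \<in> null_sets lebesgue" "{s \<in> space lebesgue. \<not> (s \<in> S \<longrightarrow> P s)} \<subseteq> N"
    unfolding eventually_ae_filter by blast
  then show "\<exists>N. negligible N \<and> (\<forall>s\<in>S - N. P s)"
    by (intro exI[of _ N]) (auto simp: negligible_iff_null_sets)
next
  assume "\<exists>N. negligible N \<and> (\<forall>s\<in>S - N. P s)"
  then obtain N where "N \<in> null_sets lebesgue" "\<forall>s\<in>S - N. P s"
    by (auto simp: negligible_iff_null_sets)
  then have "AE s in lebesgue. s \<in> S \<longrightarrow> P s"
    by (intro AE_I'[of N]) auto
  then show "AE s in lebesgue_on S. P s"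
    using assms by (simp add: AE_restrict_space_iff)
qed

text \<open>The derivative and the exceptional null set are carried as explicit witnesses, so that
  operations on curves act on them directly, without \<open>vector_derivative\<close>,
  almost-everywhere quantifiers or measurability. The length is a gauge integral of the norm of the
  projected velocity.\<close>

definition hcurve :: "(real \<Rightarrow> 'n::finite heis) \<Rightarrow> (real \<Rightarrow> 'n heis) \<Rightarrow> real set \<Rightarrow> 'n heis \<Rightarrow> 'n heis \<Rightarrow> real \<Rightarrow> bool"
  where "hcurve \<gamma> G N p q l \<longleftrightarrow> abs_continuous_curve 0 1 \<gamma> \<and> negligible N \<and> \<gamma> 0 = p \<and> \<gamma> 1 = q \<and>
    (\<forall>s\<in>{0..1} - N. (\<gamma> has_vector_derivative G s) (at s) \<and> vertical_coeff (\<gamma> s) (G s) = 0) \<and>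
    ((\<lambda>s. norm (fst (G s))) has_integral l) {0..1}"

lemma hcurve_absolutely_integrable:
  assumes "hcurve \<gamma> G N p q l"
  shows "G absolutely_integrable_on {0..1}"
  using assms abs_continuous_absolutely_integrable_derivative[of 0 1 \<gamma> N G]
  unfolding hcurve_def by simp

text \<open>On a horizontal vector the metric reduces to the Euclidean norm of its projection.
  Absolute integrability of \<open>G\<close> lets the Lebesgue integral be exchanged for the gauge
  integral.\<close>

lemma riem_length_eq_integral:
  assumes ac: "abs_continuous_curve 0 1 \<gamma>" and N: "negligible N"
    and deriv: "\<And>s. s \<in> {0..1} - N \<Longrightarrow> (\<gamma> has_vector_derivative G s) (at s)"
    and horiz: "\<And>s. s \<in> {0..1} - N \<Longrightarrow> vertical_coeff (\<gamma> s) (G s) = 0"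
  shows "((\<lambda>s. norm (fst (G s))) has_integral riem_length \<gamma>) {0..1}"
proof -
  let ?L = "\<lambda>s. sqrt (heis_metric (\<gamma> s) (vector_derivative \<gamma> (at s)) (vector_derivative \<gamma> (at s)))"
  have "G absolutely_integrable_on {0..1}"
    using abs_continuous_absolutely_integrable_derivative[OF zero_le_one ac N, of G] deriv .
  then have "(\<lambda>s. fst (G s)) absolutely_integrable_on {0..1}"
    using absolutely_integrable_linear[OF _ bounded_linear_fst, of _ G] by (simp add: o_def)
  then have int: "(\<lambda>s. norm (fst (G s))) absolutely_integrable_on {0..1}"
    by (rule absolutely_integrable_norm[unfolded o_def])
  have eq: "?L s = norm (fst (G s))" if "s \<in> {0..1} - N" for s
    using vector_derivative_at[OF deriv[OF that]] horiz[OF that]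
    by (simp add: heis_metric_inner norm_eq_sqrt_inner)
  have "?L absolutely_integrable_on {0..1}"
    by (rule absolutely_integrable_spike[OF int N eq])
  then have "integrable (lebesgue_on {0..1}) ?L"
    by (simp add: integrable_restrict_space set_integrable_def)
  then have "riem_length \<gamma> = integral {0..1} ?L"
    unfolding riem_length_def by (intro lebesgue_integral_eq_integral) auto
  also have "\<dots> = integral {0..1} (\<lambda>s. norm (fst (G s)))"
    by (intro integral_spike[OF N]) (use eq in auto)
  finally show ?thesis
    using int by (simp add: absolutely_integrable_on_def integrable_integral)
qed

definition hjoin :: "'n::finite heis \<Rightarrow> 'n heis \<Rightarrow> real \<Rightarrow> bool" where
  "hjoin p q l \<longleftrightarrow> (\<exists>\<gamma>. horizontal_curve \<gamma> \<and> pathstart \<gamma> = p \<and> pathfinish \<gamma> = q \<and> riem_length \<gamma> = l)"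

lemma hjoin_iff_hcurve: "hjoin p q l \<longleftrightarrow> (\<exists>\<gamma> G N. hcurve \<gamma> G N p q l)"
proof
  assume "hjoin p q l"
  then obtain \<gamma> where \<gamma>: "horizontal_curve \<gamma>" "\<gamma> 0 = p" "\<gamma> 1 = q" "riem_length \<gamma> = l"
    unfolding hjoin_def pathstart_def pathfinish_def by blast
  then have ac: "abs_continuous_curve 0 1 \<gamma>" by (simp add: horizontal_curve_def)
  obtain N where N: "negligible N" and
    *: "\<forall>s\<in>{0..1} - N. \<exists>v. (\<gamma> has_vector_derivative v) (at s) \<and> v \<in> horizontal_space (\<gamma> s)"
    using \<gamma>(1) unfolding horizontal_curve_def by (auto simp: AE_lebesgue_on_negligible)
  define G where "G s = vector_derivative \<gamma> (at s)" for s
  have G: "(\<gamma> has_vector_derivative G s) (at s)" "vertical_coeff (\<gamma> s) (G s) = 0"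
    if s: "s \<in> {0..1} - N" for s
  proof -
    obtain v where v: "(\<gamma> has_vector_derivative v) (at s)" "v \<in> horizontal_space (\<gamma> s)"
      using * s by blast
    then show "(\<gamma> has_vector_derivative G s) (at s)" "vertical_coeff (\<gamma> s) (G s) = 0"
      using vector_derivative_at[OF v(1)] by (auto simp: G_def horizontal_space_iff)
  qed
  then have "hcurve \<gamma> G N p q l"
    using riem_length_eq_integral[OF ac N G] \<gamma> ac N by (simp add: hcurve_def)
  then show "\<exists>\<gamma> G N. hcurve \<gamma> G N p q l" by blast
next
  assume "\<exists>\<gamma> G N. hcurve \<gamma> G N p q l"
  then obtain \<gamma> G N where \<gamma>: "hcurve \<gamma> G N p q l" by blast
  then have ac: "abs_continuous_curve 0 1 \<gamma>" and N: "negligible N"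
    and G: "\<And>s. s \<in> {0..1} - N \<Longrightarrow> (\<gamma> has_vector_derivative G s) (at s)"
      "\<And>s. s \<in> {0..1} - N \<Longrightarrow> vertical_coeff (\<gamma> s) (G s) = 0"
    by (auto simp: hcurve_def)
  have "\<forall>s\<in>{0..1} - N. \<exists>v. (\<gamma> has_vector_derivative v) (at s) \<and> v \<in> horizontal_space (\<gamma> s)"
    using G unfolding horizontal_space_iff by blast
  then have "horizontal_curve \<gamma>"
    unfolding horizontal_curve_def
    using ac N by (subst AE_lebesgue_on_negligible) auto
  moreover have "riem_length \<gamma> = l"
    using riem_length_eq_integral[OF ac N G] \<gamma> unfolding hcurve_def by (metis has_integral_unique)
  ultimately show "hjoin p q l"
    using \<gamma> unfolding hjoin_def hcurve_def pathstart_def pathfinish_def by blast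
qed

section \<open>Operations on horizontal curves\<close>

lemma negligible_affine_preimage:
  fixes N :: "real set"
  assumes "negligible N" and "m \<noteq> 0"
  shows "negligible {s. m * s + c \<in> N}"
proof -
  have "{s. m * s + c \<in> N} \<subseteq> (\<lambda>x. inverse m * (x - c)) ` N"
  proof
    fix s assume "s \<in> {s. m * s + c \<in> N}"
    then show "s \<in> (\<lambda>x. inverse m * (x - c)) ` N"
      using \<open>m \<noteq> 0\<close> by (intro image_eqI[of _ _ "m * s + c"]) auto
  qed
  moreover have "negligible ((\<lambda>x. inverse m * (x - c)) ` N)"
    using assms by (intro negligible_differentiable_image_negligible)
      (auto intro!: differentiable_on_mult differentiable_on_diff differentiable_on_ident differentiable_on_const)
  ultimately show ?thesis using negligible_subset by blast
qed

lemma has_integral_affine_real: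
  fixes f :: "real \<Rightarrow> 'a::euclidean_space"
  assumes "(f has_integral i) {m * a + c..m * b + c}" and "m > 0"
  shows "((\<lambda>s. m *\<^sub>R f (m * s + c)) has_integral i) {a..b}"
proof -
  have "(\<lambda>x. x / m - c / m) ` {m * a + c..m * b + c} = {a..b}"
    unfolding image_affinity_atLeastAtMost_div_diff using \<open>m > 0\<close> by (auto simp: field_simps)
  then have "((\<lambda>s. f (m * s + c)) has_integral (i /\<^sub>R m)) {a..b}"
    using has_integral_affinity[of f i "m * a + c" "m * b + c" m c] assms
    by (simp add: divide_inverse mult.commute)
  from has_integral_cmul[OF this, of m] show ?thesis using \<open>m > 0\<close> by simp
qed

lemma has_vector_derivative_affine_compose:
  fixes f :: "real \<Rightarrow> 'a::real_normed_vector"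
  assumes "(f has_vector_derivative v) (at (m * s + c))"
  shows "((\<lambda>s. f (m * s + c)) has_vector_derivative m *\<^sub>R v) (at s)"
proof -
  have "((\<lambda>s. m * s + c) has_vector_derivative m) (at s)"
    by (auto intro!: derivative_eq_intros)
  from vector_diff_chain_at[OF this] assms show ?thesis by (simp add: o_def)
qed

lemma has_vector_derivative_compose_has_derivative:
  assumes "(f has_vector_derivative v) (at s)" and "(h has_derivative h') (at (f s))"
  shows "((\<lambda>s. h (f s)) has_vector_derivative h' v) (at s)"
  using has_derivative_compose[OF assms(1)[unfolded has_vector_derivative_def] assms(2)]
    linear_cmul[OF has_derivative_linear[OF assms(2)]]
  by (simp add: has_vector_derivative_def)

lemma vertical_coeff_scaleR: "vertical_coeff p (r *\<^sub>R v) = r * vertical_coeff p v"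
  by (simp add: linear_cmul[OF linear_vertical_coeff] del: scaleR_Pair)

lemma hjoin_trans:
  assumes "hjoin p q l" and "hjoin q r l'"
  shows "hjoin p r (l + l')"
proof -
  obtain \<gamma>1 G1 N1 where 1: "hcurve \<gamma>1 G1 N1 p q l" using assms(1) hjoin_iff_hcurve by blast
  obtain \<gamma>2 G2 N2 where 2: "hcurve \<gamma>2 G2 N2 q r l'" using assms(2) hjoin_iff_hcurve by blast
  define \<gamma> where "\<gamma> s = (if s \<le> 1/2 then \<gamma>1 (2 * s) else \<gamma>2 (2 * s + - 1))" for s :: real
  define G where "G s = (if s \<le> 1/2 then 2 *\<^sub>R G1 (2 * s) else 2 *\<^sub>R G2 (2 * s + - 1))" for s :: real
  \<comment> \<open>The junction \<open>1/2\<close> is exceptional because the two one-sided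
    derivatives may differ there.\<close>
  define N where "N = {s. 2 * s + 0 \<in> N1} \<union> {s. 2 * s + - 1 \<in> N2} \<union> {1/2}"
  have ends: "\<gamma>1 0 = p" "\<gamma>1 1 = q" "\<gamma>2 0 = q" "\<gamma>2 1 = r"
    using 1 2 by (auto simp: hcurve_def)
  \<comment> \<open>Each curve is frozen on the half where the other one runs, so both are defined
    on all of \<open>{0..1}\<close> and together dominate the increments of
    \<open>\<gamma>\<close>.\<close>
  have ac1: "abs_continuous_curve 0 1 (\<lambda>s. \<gamma>1 (min (2 * s) 1))"
    by (rule abs_continuous_curve_reparam[of 0 1 _ 2]) (use 1 in \<open>auto simp: hcurve_def\<close>)
  have ac2: "abs_continuous_curve 0 1 (\<lambda>s. \<gamma>2 (max (2 * s + - 1) 0))"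
    by (rule abs_continuous_curve_reparam[of 0 1 _ 2]) (use 2 in \<open>auto simp: hcurve_def\<close>)
  have ac: "abs_continuous_curve 0 1 \<gamma>"
  proof (rule abs_continuous_curve_dominated[OF ac1 ac2, of 1])
    fix s t :: real assume "s \<le> t"
    then show "dist (\<gamma> s) (\<gamma> t) \<le> 1 * (dist (\<gamma>1 (min (2 * s) 1)) (\<gamma>1 (min (2 * t) 1)) +
        dist (\<gamma>2 (max (2 * s + - 1) 0)) (\<gamma>2 (max (2 * t + - 1) 0)))"
      using dist_triangle[of "\<gamma>1 (2 * s)" "\<gamma>2 (2 * t + - 1)" q]
      by (auto simp: \<gamma>_def min_def max_def ends)
  qed simp
  have N: "negligible N"
    using 1 2 negligible_affine_preimage[of N1 2 0] negligible_affine_preimage[of N2 2 "-1"]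
    by (auto simp: N_def hcurve_def)
  have deriv: "(\<gamma> has_vector_derivative G s) (at s) \<and> vertical_coeff (\<gamma> s) (G s) = 0"
    if s: "s \<in> {0..1} - N" for s
  proof (cases "s < 1/2")
    case True
    then have s': "2 * s \<in> {0..1} - N1" using s by (auto simp: N_def)
    then have "((\<lambda>s. \<gamma>1 (2 * s)) has_vector_derivative G s) (at s)"
      using has_vector_derivative_affine_compose[of \<gamma>1 "G1 (2 * s)" 2 s 0] 1 True
      by (auto simp: hcurve_def G_def)
    then have "(\<gamma> has_vector_derivative G s) (at s)"
      by (rule has_vector_derivative_transform_within_open[of _ _ _ "{..<1/2}"]) (use True in \<open>auto simp: \<gamma>_def\<close>)
    then show ?thesis
      using 1 s' True by (auto simp: hcurve_def \<gamma>_def G_def vertical_coeff_scaleR)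
  next
    case False
    then have "s > 1/2" using s by (auto simp: N_def)
    then have s': "2 * s + - 1 \<in> {0..1} - N2" using s by (auto simp: N_def)
    then have "((\<lambda>s. \<gamma>2 (2 * s + - 1)) has_vector_derivative G s) (at s)"
      using has_vector_derivative_affine_compose[of \<gamma>2 "G2 (2 * s + - 1)" 2 s "-1"] 2 \<open>s > 1/2\<close>
      by (auto simp: hcurve_def G_def)
    then have "(\<gamma> has_vector_derivative G s) (at s)"
      by (rule has_vector_derivative_transform_within_open[of _ _ _ "{1/2<..}"]) (use \<open>s > 1/2\<close> in \<open>auto simp: \<gamma>_def\<close>)
    then show ?thesis
      using 2 s' \<open>s > 1/2\<close> by (auto simp: hcurve_def \<gamma>_def G_def vertical_coeff_scaleR)
  qed
  have "((\<lambda>s. 2 *\<^sub>R norm (fst (G1 (2 * s + 0)))) has_integral l) {0..1/2}"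
    by (rule has_integral_affine_real) (use 1 in \<open>auto simp: hcurve_def\<close>)
  then have int1: "((\<lambda>s. norm (fst (G s))) has_integral l) {0..1/2}"
    by (rule has_integral_eq[rotated]) (auto simp: G_def)
  have "((\<lambda>s. 2 *\<^sub>R norm (fst (G2 (2 * s + - 1)))) has_integral l') {1/2..1}"
    by (rule has_integral_affine_real) (use 2 in \<open>auto simp: hcurve_def\<close>)
  then have int2: "((\<lambda>s. norm (fst (G s))) has_integral l') {1/2..1}"
    by (rule has_integral_spike[of "{1/2}", rotated 2]) (auto simp: G_def)
  have "((\<lambda>s. norm (fst (G s))) has_integral (l + l')) {0..1}"
    by (rule has_integral_combine[OF _ _ int1 int2]) auto
  then have "hcurve \<gamma> G N p r (l + l')"
    using ac N deriv ends by (auto simp: hcurve_def \<gamma>_def)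
  then show ?thesis using hjoin_iff_hcurve by blast
qed

text \<open>The common core of left translations (\<open>c = 1\<close>) and dilations
  (\<open>c = s\<close>): the chain rule carries the velocity \<open>G\<close> to
  \<open>h' G\<close>, which stays horizontal and has projected norm scaled by
  \<open>c\<close>.\<close>

lemma hjoin_affine_image:
  assumes "hjoin p q l" and "c \<ge> 0"
    and h': "bounded_linear h'" and h: "\<And>x. h x = a + h' x"
    and fst: "\<And>v. norm (fst (h' v)) = c * norm (fst v)"
    and vert: "\<And>x v. vertical_coeff x v = 0 \<Longrightarrow> vertical_coeff (h x) (h' v) = 0"
  shows "hjoin (h p) (h q) (c * l)"
proof -
  obtain \<gamma> G N where \<gamma>: "hcurve \<gamma> G N p q l" using assms(1) hjoin_iff_hcurve by blast
  obtain K where K: "K > 0" "\<And>x. norm (h' x) \<le> norm x * K"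
    using bounded_linear.pos_bounded[OF h'] by blast
  have lip: "dist (h x) (h y) \<le> K * dist x y" for x y
    using K(2)[of "x - y"] by (simp add: h dist_norm linear_diff[OF bounded_linear.linear[OF h']] mult.commute)
  have \<gamma>': "abs_continuous_curve 0 1 \<gamma>" "negligible N" "\<gamma> 0 = p" "\<gamma> 1 = q"
    "\<And>s. s \<in> {0..1} - N \<Longrightarrow> (\<gamma> has_vector_derivative G s) (at s)"
    "\<And>s. s \<in> {0..1} - N \<Longrightarrow> vertical_coeff (\<gamma> s) (G s) = 0"
    "((\<lambda>s. norm (fst (G s))) has_integral l) {0..1}"
    using \<gamma> unfolding hcurve_def by auto
  have deriv: "(h has_derivative h') (at x)" for x
  proof -
    have "((\<lambda>x. a + h' x) has_derivative (\<lambda>x. 0 + h' x)) (at x)"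
      by (intro has_derivative_add has_derivative_const bounded_linear_imp_has_derivative h')
    then show ?thesis by (simp add: h[abs_def])
  qed
  have "hcurve (\<lambda>s. h (\<gamma> s)) (\<lambda>s. h' (G s)) N (h p) (h q) (c * l)"
    unfolding hcurve_def
  proof (intro conjI ballI)
    show "abs_continuous_curve 0 1 (\<lambda>s. h (\<gamma> s))"
      by (rule abs_continuous_curve_lipschitz_compose[OF \<gamma>'(1) K(1) lip])
    show "((\<lambda>s. norm (fst (h' (G s)))) has_integral c * l) {0..1}"
      unfolding fst by (rule has_integral_mult_right[OF \<gamma>'(7)])
    fix s assume s: "s \<in> {0..1} - N"
    show "((\<lambda>s. h (\<gamma> s)) has_vector_derivative h' (G s)) (at s)"
      by (rule has_vector_derivative_compose_has_derivative[OF \<gamma>'(5)[OF s] deriv])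
    show "vertical_coeff (h (\<gamma> s)) (h' (G s)) = 0"
      by (rule vert[OF \<gamma>'(6)[OF s]])
  qed (simp_all add: \<gamma>')
  then show ?thesis using hjoin_iff_hcurve by blast
qed

lemma hjoin_translate:
  assumes "hjoin p q l"
  shows "hjoin (heis_mult g p) (heis_mult g q) l"
proof -
  have h': "heis_left_diff g = (\<lambda>v. (fst v, snd v + 2 * symp (fst g) (fst v)))"
    by (rule ext) (simp add: heis_left_diff_def symp_def)
  have bl: "bounded_linear (heis_left_diff g)"
    using heis_mult_has_derivative[of g 0] by (rule has_derivative_bounded_linear)
  have "hjoin (heis_mult g p) (heis_mult g q) (1 * l)"
    by (rule hjoin_affine_image[OF assms _ bl, where a = g])
      (auto simp: h' heis_mult_symp vertical_coeff_symp symp.add_left prod_eq_iff)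
  then show ?thesis by simp
qed

text \<open>Heights scale like areas: both terms of \<open>vertical_coeff\<close> are multiplied by
  \<open>s\<^sup>2\<close>, so horizontality is preserved, including the case
  \<open>s = 0\<close>.\<close>

lemma hjoin_dilate:
  assumes "hjoin p q l" and "s \<ge> 0"
  shows "hjoin (s *\<^sub>R fst p, s\<^sup>2 * snd p) (s *\<^sub>R fst q, s\<^sup>2 * snd q) (s * l)"
proof -
  have bl: "bounded_linear (\<lambda>p. (s *\<^sub>R fst p, s\<^sup>2 * snd p))"
    by (intro bounded_linear_Pair bounded_linear_intros)
  show ?thesis
    by (rule hjoin_affine_image[OF assms bl, where a = 0])
      (use \<open>s \<ge> 0\<close> in \<open>auto simp: vertical_coeff_symp symp.scaleR_left symp.scaleR_right zero_prod_def power2_eq_square\<close>)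
qed

lemma heis_mult_assoc: "heis_mult (heis_mult p q) r = heis_mult p (heis_mult q r)"
  by (simp add: heis_mult_symp symp.add_left symp.add_right)

lemma heis_mult_0 [simp]: "heis_mult 0 p = p" "heis_mult p 0 = p"
  by (simp_all add: heis_mult_symp symp.zero_left symp.zero_right)

lemma heis_mult_uminus [simp]: "heis_mult p (- p) = 0" "heis_mult (- p) p = 0"
  by (simp_all add: heis_mult_symp symp.minus_left symp.minus_right zero_prod_def)

text \<open>A straight segment from the origin encloses no area, as \<open>symp v v = 0\<close>, and
  so keeps height 0. Left translation moves its starting point to \<open>p\<close>.\<close>

lemma hjoin_segment: "hjoin p (heis_mult p (v, 0)) (norm v)"
proof -
  have "hcurve (\<lambda>s. (s *\<^sub>R v, 0)) (\<lambda>s. (v, 0)) {} 0 (v, 0) (norm v)"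
    unfolding hcurve_def
  proof (intro conjI ballI)
    show "abs_continuous_curve 0 1 (\<lambda>s. (s *\<^sub>R v, 0::real))"
    proof (rule abs_continuous_curve_lipschitz_compose[OF abs_continuous_curve_ident])
      show "norm v + 1 > 0" using norm_ge_zero[of v] by linarith
      show "dist (x *\<^sub>R v, 0::real) (y *\<^sub>R v, 0) \<le> (norm v + 1) * dist x y" for x y
        by (simp add: dist_Pair_Pair dist_norm distrib_right flip: scaleR_diff_left)
    qed
    show "((\<lambda>s. (s *\<^sub>R v, 0::real)) has_vector_derivative (v, 0)) (at s)" for s
      by (auto intro!: derivative_eq_intros has_vector_derivative_Pair)
    show "((\<lambda>s. norm (fst (v, 0::real))) has_integral norm v) {0..1::real}"
      using has_integral_const_real[of "norm v" 0 1] by simp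
  qed (auto simp: zero_prod_def vertical_coeff_symp symp.scaleR_left)
  then have "hjoin 0 (v, 0) (norm v)" using hjoin_iff_hcurve by blast
  from hjoin_translate[OF this, of p] show ?thesis by simp
qed

lemma symp_axis: "symp (axis j 1) (axis j \<i>) = - 1"
proof -
  have "symp (axis j 1) (axis j \<i>) = Im (\<Sum>i\<in>UNIV. if i = j then - \<i> else 0)"
    unfolding symp_def by (intro arg_cong[where f = Im] sum.cong) (auto simp: axis_def)
  then show ?thesis by simp
qed

text \<open>The vertical part is reached along the boundary of a square in one complex coordinate.\<close>

lemma hjoin_0: "hjoin 0 (z :: complex ^ 'n::finite, t) (norm z + 2 * sqrt \<bar>t\<bar>)"
proof -
  \<comment> \<open>Index types are inhabited, so at least one complex coordinate exists.\<close>
  obtain j :: 'n where True by blast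
  define e f :: "complex ^ 'n" where "e = axis j 1" and "f = axis j \<i>"
  \<comment> \<open>Going around a rectangle with signed sides \<open>x\<close> and \<open>y\<close>
    raises the height by \<open>- 4 * x * y\<close>. The sign of \<open>y\<close> fixes the
    orientation, and four sides of length \<open>x\<close> give the total
    \<open>2 * sqrt \<bar>t\<bar>\<close>.\<close>
  define x where "x = sqrt \<bar>t\<bar> / 2"
  define y where "y = - sgn t * x"
  have ef: "symp e f = - 1" "symp f e = 1" "norm e = 1" "norm f = 1"
    using symp_axis[of j] symp_commute[of f e] by (auto simp: e_def f_def)
  have xy: "- 4 * x * y = t" "\<bar>y\<bar> = x" "x \<ge> 0"
    by (auto simp: x_def y_def abs_mult sgn_if power2_eq_square)
  note segs = hjoin_trans[OF hjoin_trans[OF hjoin_trans[OF hjoin_segment hjoin_segment] hjoin_segment] hjoin_segment]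
  have "hjoin 0 (heis_mult (heis_mult (heis_mult (heis_mult 0 (x *\<^sub>R e, 0)) (y *\<^sub>R f, 0)) (- x *\<^sub>R e, 0)) (- y *\<^sub>R f, 0))
    (norm (x *\<^sub>R e) + norm (y *\<^sub>R f) + norm (- x *\<^sub>R e) + norm (- y *\<^sub>R f))"
    by (rule segs)
  also have "heis_mult (heis_mult (heis_mult (heis_mult 0 (x *\<^sub>R e, 0)) (y *\<^sub>R f, 0)) (- x *\<^sub>R e, 0)) (- y *\<^sub>R f, 0) = (0, t)"
    using xy(1) by (simp add: heis_mult_symp symp.add_left symp.scaleR_left symp.scaleR_right symp.minus_left symp.minus_right
        symp.zero_left ef)
  also have "norm (x *\<^sub>R e) + norm (y *\<^sub>R f) + norm (- x *\<^sub>R e) + norm (- y *\<^sub>R f) = 2 * sqrt \<bar>t\<bar>"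
    using xy(2,3) by (simp add: ef) (simp add: x_def)
  finally have "hjoin 0 (0 :: complex ^ 'n, t) (2 * sqrt \<bar>t\<bar>)" .
  from hjoin_trans[OF this hjoin_segment[of _ z]] show ?thesis
    by (simp add: heis_mult_symp symp.zero_left add.commute)
qed

section \<open>The Carnot-Caratheodory distance\<close>

lemma norm_has_integral_initial_le:
  fixes f :: "real \<Rightarrow> 'a::euclidean_space"
  assumes "f absolutely_integrable_on {0..1}" and "(f has_integral x) {0..s}" and "s \<in> {0..1}"
  shows "norm x \<le> integral {0..1} (\<lambda>s. norm (f s))"
proof -
  have int: "(\<lambda>s. norm (f s)) integrable_on {0..1}"
    using assms(1) by (simp add: absolutely_integrable_on_def)
  then have int_s: "(\<lambda>s. norm (f s)) integrable_on {0..s}"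
    using assms(3) by (intro integrable_on_subinterval[OF int]) auto
  have "norm x = norm (integral {0..s} f)" using assms(2) by (simp add: integral_unique)
  also have "\<dots> \<le> integral {0..s} (\<lambda>s. norm (f s))"
    using assms(2) int_s by (intro integral_norm_bound_integral) auto
  also have "\<dots> \<le> integral {0..1} (\<lambda>s. norm (f s))"
    using assms(3) by (intro integral_subset_le int int_s) auto
  finally show ?thesis .
qed

text \<open>Arithmetic-geometric mean inequality for the two factors of
  \<open>(norm x)\<^sup>2 - (x \<bullet> e)\<^sup>2\<close>.\<close>

lemma norm_transverse_le:
  fixes x e :: "'a::real_inner"
  assumes "norm e \<le> 1" and "c > 0"
  shows "norm (x - (x \<bullet> e) *\<^sub>R e) \<le> c * (norm x - x \<bullet> e) + norm x / c"
proof (rule power2_le_imp_le)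
  have "\<bar>x \<bullet> e\<bar> \<le> norm x * norm e" by (rule Cauchy_Schwarz_ineq2)
  also have "\<dots> \<le> norm x" using assms(1) by (simp add: mult_left_le)
  finally have xe: "\<bar>x \<bullet> e\<bar> \<le> norm x" .
  define a b where "a = norm x - x \<bullet> e" and "b = norm x"
  have ab: "a \<ge> 0" "b \<ge> 0" "2 * b - a \<le> 2 * b" using xe by (auto simp: a_def b_def)
  have "e \<bullet> e \<le> 1" using assms(1) by (simp add: dot_square_norm power_le_one)
  then have "(x \<bullet> e)\<^sup>2 * (e \<bullet> e) \<le> (x \<bullet> e)\<^sup>2" by (simp add: mult_left_le)
  then have "(norm (x - (x \<bullet> e) *\<^sub>R e))\<^sup>2 \<le> (norm x)\<^sup>2 - (x \<bullet> e)\<^sup>2"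
    unfolding power2_norm_eq_inner
    by (simp add: inner_diff_left inner_diff_right inner_commute[of e x] power2_eq_square algebra_simps)
  also have "\<dots> = a * (2 * b - a)" by (simp add: a_def b_def power2_eq_square algebra_simps)
  also have "\<dots> \<le> a * (2 * b)" using ab by (intro mult_left_mono) auto
  \<comment> \<open>With the factor 4 the difference to \<open>(c * a + b / c)\<^sup>2\<close>
    becomes a perfect square.\<close>
  also have "\<dots> \<le> 4 * (a * b)" using ab by simp
  also have "\<dots> \<le> (c * a + b / c)\<^sup>2"
  proof -
    have "(c * a + b / c)\<^sup>2 - 4 * (a * b) = (c * a - b / c)\<^sup>2"
      using \<open>c > 0\<close> by (simp add: power2_eq_square field_simps)
    then show ?thesis by (metis diff_ge_0_iff_ge zero_le_power2)
  qed
  finally show "(norm (x - (x \<bullet> e) *\<^sub>R e))\<^sup>2 \<le> (c * (norm x - x \<bullet> e) + norm x / c)\<^sup>2"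
    by (simp add: a_def b_def)
  show "0 \<le> c * (norm x - x \<bullet> e) + norm x / c" using xe \<open>c > 0\<close> by simp
qed

lemma hcurve_has_integral:
  assumes "hcurve \<gamma> G N p q l" and "s \<in> {0..1}"
  shows "(G has_integral (\<gamma> s - p)) {0..s}"
proof -
  have "(G has_integral (\<gamma> s - \<gamma> 0)) {0..s}"
    by (rule abs_continuous_has_integral_derivative[of _ _ _ N])
      (use assms in \<open>auto simp: hcurve_def intro: abs_continuous_curve_subset\<close>)
  then show ?thesis using assms(1) by (simp add: hcurve_def)
qed

text \<open>The projected curve has the same length and joins 0 to \<open>z\<close> in Euclidean
  space, where no curve is shorter than the chord.\<close>

lemma hjoin_norm_le:
  assumes "hjoin 0 (z, t) l"
  shows "norm z \<le> l"
proof -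
  obtain \<gamma> G N where \<gamma>: "hcurve \<gamma> G N 0 (z, t) l" using assms hjoin_iff_hcurve by blast
  have "((\<lambda>s. fst (G s)) has_integral z) {0..1}"
    using has_integral_linear[OF hcurve_has_integral[OF \<gamma>, of 1] bounded_linear_fst] \<gamma>
    by (simp add: o_def hcurve_def)
  moreover have "(\<lambda>s. fst (G s)) absolutely_integrable_on {0..1}"
    using absolutely_integrable_linear[OF hcurve_absolutely_integrable[OF \<gamma>] bounded_linear_fst] by (simp add: o_def)
  ultimately have "norm z \<le> integral {0..1} (\<lambda>s. norm (fst (G s)))"
    by (intro norm_has_integral_initial_le[where s = 1]) auto
  also have "\<dots> = l" using \<gamma> by (auto simp: hcurve_def integral_unique)
  finally show ?thesis .
qed

text \<open>A curve that is not much longer than the segment from \<open>0\<close> to \<open>z\<close> stays close to it and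
  therefore encloses little area.  Optimizing over \<open>c\<close> turns the last factor into
  \<open>2 * sqrt (l * (l - norm z))\<close>.\<close>

lemma hjoin_height:
  "\<exists>K>0. \<forall>z t l c. hjoin (0 :: 'n::finite heis) (z, t) l \<and> c > 0
    \<longrightarrow> \<bar>t\<bar> \<le> K * l * (c * (l - norm z) + l / c)"
proof -
  obtain C where C: "C > 0" "\<And>a b :: complex ^ 'n. norm (symp a b) \<le> norm a * norm b * C"
    using symp.pos_bounded by blast
  show ?thesis
  proof (intro exI[of _ "4 * C"] conjI allI impI; (elim conjE)?)
    fix z :: "complex ^ 'n" and t l c :: real
    assume hj: "hjoin 0 (z, t) l" and "c > 0"
    obtain \<gamma> G N where \<gamma>: "hcurve \<gamma> G N 0 (z, t) l" using hj hjoin_iff_hcurve by blast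
    \<comment> \<open>The direction of the segment. For \<open>z = 0\<close> it is 0, and the
      properties below hold without a case distinction.\<close>
    define e where "e = sgn z"
    have e: "norm e \<le> 1" "z \<bullet> e = norm z"
      by (cases "z = 0"; simp add: e_def norm_sgn sgn_div_norm dot_square_norm power2_eq_square)+
    define H where "H s = fst (G s)" for s
    define W where "W s = H s - (H s \<bullet> e) *\<^sub>R e" for s
    define w where "w x = x - (x \<bullet> e) *\<^sub>R e" for x
    have bl_w: "bounded_linear w"
      unfolding w_def by (intro bounded_linear_sub bounded_linear_ident bounded_linear_scaleR_const bounded_linear_inner_left)
    have ai_H: "H absolutely_integrable_on {0..1}"
      using absolutely_integrable_linear[OF hcurve_absolutely_integrable[OF \<gamma>] bounded_linear_fst]
      by (simp add: o_def H_def[abs_def])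
    have ai_W: "W absolutely_integrable_on {0..1}"
      using absolutely_integrable_linear[OF ai_H bl_w] by (simp add: o_def W_def[abs_def] w_def)
    have hi_H: "(H has_integral fst (\<gamma> s)) {0..s}" if "s \<in> {0..1}" for s
      using has_integral_linear[OF hcurve_has_integral[OF \<gamma> that] bounded_linear_fst]
      by (simp add: o_def H_def[abs_def])
    have hi_W: "(W has_integral w (fst (\<gamma> s))) {0..s}" if "s \<in> {0..1}" for s
      using has_integral_linear[OF hi_H[OF that] bl_w] by (simp add: o_def W_def[abs_def] w_def)
    have l: "((\<lambda>s. norm (H s)) has_integral l) {0..1}"
      using \<gamma> by (simp add: hcurve_def H_def)
    define I where "I = integral {0..1} (\<lambda>s. norm (W s))"
    have I: "((\<lambda>s. norm (W s)) has_integral I) {0..1}"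
      using ai_W by (simp add: I_def absolutely_integrable_on_def integrable_integral)
    have norm_c: "norm (fst (\<gamma> s)) \<le> l" if "s \<in> {0..1}" for s
      using norm_has_integral_initial_le[OF ai_H hi_H[OF that] that] l by (simp add: integral_unique)
    have norm_w: "norm (w (fst (\<gamma> s))) \<le> I" if "s \<in> {0..1}" for s
      using norm_has_integral_initial_le[OF ai_W hi_W[OF that] that] by (simp add: I_def)
    have "l \<ge> 0" "I \<ge> 0" using order_trans[OF norm_ge_zero norm_c[of 0]] order_trans[OF norm_ge_zero norm_w[of 0]] by simp_all
    have "((\<lambda>s. H s \<bullet> e) has_integral z \<bullet> e) {0..1}"
      using has_integral_linear[OF hi_H[of 1] bounded_linear_inner_left[of e]] \<gamma>
      by (simp add: o_def hcurve_def)
    then have "((\<lambda>s. c * (norm (H s) - H s \<bullet> e) + norm (H s) / c) has_integral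
        (c * (l - norm z) + l / c)) {0..1}"
      unfolding e(2)
      by (intro has_integral_add has_integral_mult_right has_integral_diff has_integral_divide l)
    \<comment> \<open>The longitudinal velocity integrates to \<open>norm z\<close>, so integrating
      \<open>norm_transverse_le\<close> produces the excess length
      \<open>l - norm z\<close>.\<close>
    then have I_le: "I \<le> c * (l - norm z) + l / c"
      by (rule has_integral_le[OF I]) (simp add: W_def norm_transverse_le[OF e(1) \<open>c > 0\<close>])
    \<comment> \<open>The value 0 on \<open>N\<close> makes the pointwise bound hold on the whole
      interval.\<close>
    define T where "T s = (if s \<in> N then 0 else snd (G s))" for s
    have "((\<lambda>s. snd (G s)) has_integral t) {0..1}"
      using has_integral_linear[OF hcurve_has_integral[OF \<gamma>, of 1] bounded_linear_snd] \<gamma>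
      by (simp add: o_def hcurve_def)
    then have hi_T: "(T has_integral t) {0..1}"
      by (rule has_integral_spike[of N, rotated 2]) (use \<gamma> in \<open>auto simp: hcurve_def T_def\<close>)
    have bound: "norm (T s) \<le> 2 * C * (l * norm (W s) + I * norm (H s))" if s: "s \<in> {0..1}" for s
    proof (cases "s \<in> N")
      case True
      then show ?thesis using C(1) \<open>l \<ge> 0\<close> \<open>I \<ge> 0\<close> by (simp add: T_def)
    next
      case False
      let ?c = "fst (\<gamma> s)"
      have "vertical_coeff (\<gamma> s) (G s) = 0" using \<gamma> s False by (simp add: hcurve_def)
      then have "T s = 2 * symp ?c (H s)"
        using False by (simp add: T_def vertical_coeff_symp H_def)
      \<comment> \<open>Position and velocity are split along \<open>e\<close>. The product of the
        two longitudinal parts vanishes by \<open>symp e e = 0\<close>, so each remaining term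
        contains a transverse factor.\<close>
      moreover have "symp ?c (H s) = (?c \<bullet> e) * symp e (W s) + symp (w ?c) (H s)"
        by (simp add: w_def W_def symp.diff_left symp.diff_right symp.scaleR_left symp.scaleR_right)
      moreover have "\<bar>(?c \<bullet> e) * symp e (W s)\<bar> \<le> C * (l * norm (W s))"
      proof -
        have "\<bar>?c \<bullet> e\<bar> \<le> norm ?c * norm e" by (rule Cauchy_Schwarz_ineq2)
        also have "\<dots> \<le> l * 1" using norm_c[OF s] e(1) \<open>l \<ge> 0\<close> by (intro mult_mono) auto
        finally have ce: "\<bar>?c \<bullet> e\<bar> \<le> l" by simp
        have "\<bar>symp e (W s)\<bar> \<le> norm e * norm (W s) * C" using C(2) by simp
        also have "\<dots> \<le> 1 * norm (W s) * C" using e(1) C(1) by (intro mult_right_mono) auto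
        finally have "\<bar>?c \<bullet> e\<bar> * \<bar>symp e (W s)\<bar> \<le> l * (1 * norm (W s) * C)"
          using ce \<open>l \<ge> 0\<close> by (intro mult_mono) auto
        then show ?thesis by (simp add: abs_mult ac_simps)
      qed
      moreover have "\<bar>symp (w ?c) (H s)\<bar> \<le> C * (I * norm (H s))"
      proof -
        have "\<bar>symp (w ?c) (H s)\<bar> \<le> norm (w ?c) * norm (H s) * C" using C(2) by simp
        also have "\<dots> \<le> I * norm (H s) * C"
          using norm_w[OF s] C(1) by (intro mult_right_mono) auto
        finally show ?thesis by (simp add: ac_simps)
      qed
      ultimately show ?thesis by (simp add: distrib_left)
    qed
    have hi_bound: "((\<lambda>s. 2 * C * (l * norm (W s) + I * norm (H s))) has_integral 2 * C * (l * I + I * l)) {0..1}"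
      by (intro has_integral_add has_integral_mult_right l I)
    have "norm t \<le> 2 * C * (l * I + I * l)"
      using integral_norm_bound_integral[OF has_integral_integrable[OF hi_T]
          has_integral_integrable[OF hi_bound] bound]
      unfolding integral_unique[OF hi_T] integral_unique[OF hi_bound] .
    also have "\<dots> = 4 * C * l * I" by simp
    also have "\<dots> \<le> 4 * C * l * (c * (l - norm z) + l / c)"
      using I_le C(1) \<open>l \<ge> 0\<close> by (intro mult_left_mono) auto
    finally show "\<bar>t\<bar> \<le> 4 * C * l * (c * (l - norm z) + l / c)" by simp
  qed (use C in simp)
qed

lemma cc_dist_eq_Inf: "cc_dist p q = Inf {l. hjoin p q l}"
  unfolding cc_dist_def hjoin_def by (rule arg_cong[where f = Inf]) auto

lemma hjoin_exists: "\<exists>l. hjoin p q l"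
  using hjoin_translate[OF hjoin_0[of "fst (heis_mult (- p) q)" "snd (heis_mult (- p) q)"], of p]
  by (auto simp flip: heis_mult_assoc)

lemma hjoin_left_iff: "hjoin p q l \<longleftrightarrow> hjoin 0 (heis_mult (- p) q) l"
  using hjoin_translate[of p q l "- p"] hjoin_translate[of 0 "heis_mult (- p) q" l p]
  by (auto simp flip: heis_mult_assoc)

lemma cc_dist_left: "cc_dist p q = cc_dist 0 (heis_mult (- p) q)"
  using hjoin_left_iff[of p q] by (simp add: cc_dist_eq_Inf)

lemma hjoin_nonneg:
  assumes "hjoin p q l"
  shows "l \<ge> 0"
proof -
  obtain z t where "heis_mult (- p) q = (z, t)" by (cases "heis_mult (- p) q")
  then have "norm z \<le> l" using assms hjoin_left_iff[of p q l] hjoin_norm_le by metis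
  then show ?thesis using norm_ge_zero[of z] by linarith
qed

lemma cc_dist_le: "hjoin p q l \<Longrightarrow> cc_dist p q \<le> l"
  unfolding cc_dist_eq_Inf by (rule cInf_lower) (auto intro: bdd_belowI[of _ 0] hjoin_nonneg)

lemma cc_dist_approx:
  assumes "cc_dist p q < r"
  obtains l where "hjoin p q l" "cc_dist p q \<le> l" "l < r"
proof -
  have "Inf {l. hjoin p q l} < r" using assms by (simp add: cc_dist_eq_Inf)
  moreover have "{l. hjoin p q l} \<noteq> {}" using hjoin_exists[of p q] by simp
  ultimately obtain l where "hjoin p q l" "l < r"
    using cInf_lessD[of "{l. hjoin p q l}" r] by blast
  with that cc_dist_le show thesis by blast
qed

lemma cc_dist_0_upper: "cc_dist 0 (z, t) \<le> norm z + 2 * sqrt \<bar>t\<bar>"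
  by (rule cc_dist_le[OF hjoin_0])

text \<open>The left-hand point is the product of \<open>(z, t)\<close> with \<open>(v, 0)\<close>,
  reached by appending a horizontal segment of length \<open>norm v\<close>.\<close>

lemma cc_dist_0_right_translate:
  "cc_dist 0 (z + v, t + 2 * symp z v) \<le> cc_dist 0 (z, t) + norm v"
proof (rule field_le_epsilon)
  fix \<epsilon> :: real assume "\<epsilon> > 0"
  then obtain l where l: "hjoin 0 (z, t) l" "l < cc_dist 0 (z, t) + \<epsilon>"
    using cc_dist_approx[of 0 "(z, t)" "cc_dist 0 (z, t) + \<epsilon>"] by auto
  have "hjoin 0 (z + v, t + 2 * symp z v) (l + norm v)"
    using hjoin_trans[OF l(1) hjoin_segment[of _ v]] by (simp add: heis_mult_symp)
  from cc_dist_le[OF this] show "cc_dist 0 (z + v, t + 2 * symp z v) \<le> cc_dist 0 (z, t) + norm v + \<epsilon>"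
    using l(2) by simp
qed

text \<open>Dilating a curve by \<open>s\<close> and appending the segment from \<open>s z\<close> to \<open>z\<close>, which encloses no
  further area.\<close>

lemma cc_dist_0_shrink:
  assumes "0 \<le> s" "s \<le> 1"
  shows "cc_dist 0 (z, s\<^sup>2 * t) \<le> s * cc_dist 0 (z, t) + (1 - s) * norm z"
proof (rule field_le_epsilon)
  fix \<epsilon> :: real assume "\<epsilon> > 0"
  then obtain l where l: "hjoin 0 (z, t) l" "l < cc_dist 0 (z, t) + \<epsilon>"
    using cc_dist_approx[of 0 "(z, t)" "cc_dist 0 (z, t) + \<epsilon>"] by auto
  have "hjoin 0 (s *\<^sub>R z, s\<^sup>2 * t) (s * l)"
    using hjoin_dilate[OF l(1) \<open>0 \<le> s\<close>] by (simp add: zero_prod_def)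
  from hjoin_trans[OF this hjoin_segment[of _ "(1 - s) *\<^sub>R z"]]
  have "hjoin 0 (z, s\<^sup>2 * t) (s * l + (1 - s) * norm z)"
    using assms by (simp add: heis_mult_symp symp.scaleR_left symp.scaleR_right flip: scaleR_add_left)
  from cc_dist_le[OF this] have "cc_dist 0 (z, s\<^sup>2 * t) \<le> s * l + (1 - s) * norm z" .
  also have "s * l \<le> s * cc_dist 0 (z, t) + s * \<epsilon>"
    using l(2) assms(1) by (metis distrib_left mult_left_mono order_less_imp_le)
  also have "s * \<epsilon> \<le> \<epsilon>" using assms \<open>\<epsilon> > 0\<close> by (simp add: mult_left_le_one_le)
  finally show "cc_dist 0 (z, s\<^sup>2 * t) \<le> s * cc_dist 0 (z, t) + (1 - s) * norm z + \<epsilon>" by simp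
qed

lemma norm_le_cc_dist_0: "norm z \<le> cc_dist 0 (z, t)"
proof (rule field_le_epsilon)
  fix \<epsilon> :: real assume "\<epsilon> > 0"
  then obtain l where "hjoin 0 (z, t) l" "l < cc_dist 0 (z, t) + \<epsilon>"
    using cc_dist_approx[of 0 "(z, t)" "cc_dist 0 (z, t) + \<epsilon>"] by auto
  then show "norm z \<le> cc_dist 0 (z, t) + \<epsilon>" using hjoin_norm_le by fastforce
qed

lemma cc_dist_0_height:
  "\<exists>K>0. \<forall>z t D c. cc_dist 0 (z :: complex ^ 'n::finite, t) \<le> D \<and> c > 0
    \<longrightarrow> \<bar>t\<bar> \<le> K * D * (c * (D - norm z) + D / c)"
proof -
  obtain K where K: "K > 0" "\<forall>z t l c. hjoin (0 :: 'n heis) (z, t) l \<and> c > 0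
    \<longrightarrow> \<bar>t\<bar> \<le> K * l * (c * (l - norm z) + l / c)"
    using hjoin_height[where 'n = 'n] by blast
  show ?thesis
  proof (intro exI[of _ K] conjI allI impI K(1); (elim conjE)?)
    fix z :: "complex ^ 'n" and t D c :: real
    assume D: "cc_dist 0 (z, t) \<le> D" and "c > 0"
    let ?f = "\<lambda>x. K * x * (c * (x - norm z) + x / c)"
    have "\<bar>t\<bar> \<le> ?f x" if "D < x" for x
    proof -
      obtain l where l: "hjoin 0 (z, t) l" "l < x"
        using cc_dist_approx[of 0 "(z, t)" x] D \<open>D < x\<close> by auto
      have "\<bar>t\<bar> \<le> ?f l" using K(2) l(1) \<open>c > 0\<close> by blast
      also have "\<dots> \<le> ?f x"
        using l hjoin_norm_le[OF l(1)] hjoin_nonneg[OF l(1)] K(1) \<open>c > 0\<close>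
        by (intro mult_mono add_mono divide_right_mono add_nonneg_nonneg mult_nonneg_nonneg) auto
      finally show ?thesis .
    qed
    then have "\<forall>\<^sub>F x in at_right D. \<bar>t\<bar> \<le> ?f x"
      by (auto simp: eventually_at_right_field intro!: exI[of _ "D + 1"])
    moreover have "(?f \<longlongrightarrow> ?f D) (at_right D)"
      using \<open>c > 0\<close> by (intro tendsto_intros) auto
    ultimately show "\<bar>t\<bar> \<le> ?f D"
      by (intro tendsto_lowerbound[of ?f _ "at_right D"]) auto
  qed
qed

section \<open>Cones at boundary points\<close>

text \<open>If \<open>D - norm z\<close> were tiny, the height bound with a suitable large
  \<open>c\<close> would force \<open>\<bar>t\<bar>\<close> below \<eta>. The resulting \<delta>
  depends only on \<open>D\<close> and \<eta>.\<close>

lemma cc_dist_0_gap: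
  assumes "\<eta> > 0"
  shows "\<exists>\<delta>>0. \<forall>z t. cc_dist 0 (z :: complex ^ 'n::finite, t) \<le> D \<and> \<eta> \<le> \<bar>t\<bar> \<longrightarrow> \<delta> \<le> D - norm z"
proof -
  obtain K where K: "K > 0" "\<And>z t c. \<lbrakk>cc_dist 0 (z :: complex ^ 'n, t) \<le> D; c > 0\<rbrakk>
    \<Longrightarrow> \<bar>t\<bar> \<le> K * D * (c * (D - norm z) + D / c)"
    using cc_dist_0_height[where 'n = 'n] by blast
  show ?thesis
  proof (cases "D > 0")
    case True
    \<comment> \<open>With this \<open>c\<close> the term \<open>D / c\<close> accounts for exactly
      half of \<eta>, leaving the other half to \<open>D - norm z\<close>.\<close>
    define c where "c = 2 * K * D\<^sup>2 / \<eta>"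
    have "c > 0" using True K(1) assms by (simp add: c_def)
    have cD: "K * D * (D / c) = \<eta> / 2"
      unfolding c_def using True K(1) assms by (simp add: power2_eq_square)
    have pos: "K * D * c > 0" using True K(1) \<open>c > 0\<close> by simp
    have "\<eta> / (2 * (K * D * c)) \<le> D - norm z"
      if z: "cc_dist 0 (z :: complex ^ 'n, t) \<le> D \<and> \<eta> \<le> \<bar>t\<bar>" for z t
    proof -
      have "\<eta> \<le> K * D * (c * (D - norm z) + D / c)"
        using K(2)[of z t c] z \<open>c > 0\<close> by linarith
      also have "\<dots> = K * D * c * (D - norm z) + \<eta> / 2" by (simp only: distrib_left cD mult.assoc[symmetric])
      finally have "\<eta> \<le> (D - norm z) * (2 * (K * D * c))" by (simp add: algebra_simps)
      then show ?thesis using pos by (subst pos_divide_le_eq) auto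
    qed
    then show ?thesis using pos assms by (intro exI[of _ "\<eta> / (2 * (K * D * c))"]) auto
  next
    \<comment> \<open>Here the premises are contradictory: distances are nonnegative and
      \<open>D = 0\<close> forces height 0. The gap 1 is arbitrary.\<close>
    case False
    have "\<not> (cc_dist 0 (z :: complex ^ 'n, t) \<le> D \<and> \<eta> \<le> \<bar>t\<bar>)" for z t
    proof
      assume z: "cc_dist 0 (z, t) \<le> D \<and> \<eta> \<le> \<bar>t\<bar>"
      then have "D = 0" using False norm_le_cc_dist_0[of z t] norm_ge_zero[of z] by linarith
      then have "\<bar>t\<bar> \<le> 0" using K(2)[of z t 1] z by simp
      then show False using z assms by linarith
    qed
    then show ?thesis by (intro exI[of _ 1]) auto
  qed
qed

text \<open>Dilating from height \<open>\<tau>'\<close> to \<tau> takes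
  \<open>s\<^sup>2 = \<tau> / \<tau>'\<close>. This gains at least \<open>(1 - s) * \<delta>\<close>
  over \<open>D\<close>, while the excess \<open>r\<close> in the distance costs only
  \<open>s * r\<close>. The last hypothesis makes the gain prevail, since
  \<open>1 - s\<^sup>2 \<le> 2 * (1 - s)\<close> bounds \<open>1 - s\<close> from below by the
  relative change of height.\<close>

lemma cc_dist_0_shrink_strict:
  assumes dist: "cc_dist 0 (z, \<tau>') \<le> D + r" and "r \<ge> 0" and "\<delta> > 0" "\<delta> \<le> D - norm z"
    and between: "0 \<le> \<tau> \<and> \<tau> < \<tau>' \<or> \<tau>' < \<tau> \<and> \<tau> \<le> 0"
    and M: "\<bar>\<tau>'\<bar> \<le> M" "2 * M * r \<le> \<delta> * \<bar>\<tau>' - \<tau>\<bar>"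
  shows "cc_dist 0 (z, \<tau>) < D"
proof -
  define s where "s = sqrt (\<tau> / \<tau>')"
  have "\<tau>' \<noteq> 0" using between by auto
  have ratio: "0 \<le> \<tau> / \<tau>'" "\<tau> / \<tau>' < 1"
    using between by (auto simp: divide_less_eq zero_le_divide_iff)
  then have s: "0 \<le> s" "s < 1" "s\<^sup>2 = \<tau> / \<tau>'" by (simp_all add: s_def)
  have "\<bar>\<tau>'\<bar> * (1 - s\<^sup>2) = \<bar>\<tau>' - \<tau>\<bar>"
    unfolding s(3) using between by (auto simp: field_simps abs_if)
  moreover have "\<bar>\<tau>'\<bar> * (1 - s\<^sup>2) \<le> M * (2 * (1 - s))"
  proof (intro mult_mono M(1))
    have "0 \<le> (1 - s)\<^sup>2" by simp
    then show "1 - s\<^sup>2 \<le> 2 * (1 - s)" by (simp add: power2_diff)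
    show "0 \<le> 1 - s\<^sup>2" using s(3) ratio(2) by simp
  qed (use M(1) in auto)
  ultimately have "2 * M * r \<le> \<delta> * (M * (2 * (1 - s)))"
    using M(2) mult_left_mono[of "\<bar>\<tau>' - \<tau>\<bar>" "M * (2 * (1 - s))" \<delta>] \<open>\<delta> > 0\<close> by linarith
  then have "M * r \<le> M * (\<delta> * (1 - s))" by (simp add: algebra_simps)
  moreover have "M > 0" using M(1) \<open>\<tau>' \<noteq> 0\<close> by linarith
  ultimately have r: "r \<le> \<delta> * (1 - s)" by simp
  \<comment> \<open>Strictness comes from \<open>\<delta> > 0\<close> if \<open>r = 0\<close>, and
    from \<open>s < 1\<close> otherwise.\<close>
  have sr: "s * r < \<delta> * (1 - s)"
  proof (cases "r = 0")
    case True
    then show ?thesis using \<open>\<delta> > 0\<close> s by simp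
  next
    case False
    then have "s * r < 1 * r" using \<open>r \<ge> 0\<close> s by (intro mult_strict_right_mono) auto
    then show ?thesis using r by simp
  qed
  have "\<delta> * (1 - s) \<le> (D - norm z) * (1 - s)" using assms(4) s by (intro mult_right_mono) auto
  have "cc_dist 0 (z, \<tau>) \<le> s * cc_dist 0 (z, \<tau>') + (1 - s) * norm z"
    using cc_dist_0_shrink[of s z \<tau>'] s \<open>\<tau>' \<noteq> 0\<close> by simp
  also have "\<dots> \<le> s * (D + r) + (1 - s) * norm z" using dist s by (simp add: mult_left_mono)
  also have "\<dots> = D + s * r - (D - norm z) * (1 - s)" by (simp add: algebra_simps)
  also have "\<dots> < D" using sr \<open>\<delta> * (1 - s) \<le> _\<close> by linarith
  finally show ?thesis .
qed

lemma cc_dist_coordinates: "cc_dist (z, t) (w, s) = cc_dist 0 (w - z, s - t - 2 * symp z w)"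
  by (subst cc_dist_left) (simp add: heis_mult_symp symp.minus_left)

text \<open>Both cone points are moved onto the fibre over \<open>z\<close>, at a cost in distance
  and in height proportional to their horizontal offset; the slope \<open>L\<close> pays for both.
  The relative height of \<open>(w, s)\<close> seen from \<open>(z, t)\<close> then lies strictly
  between those seen from the moved points, one of which is farther from 0 on the same side, so
  \<open>cc_dist_0_shrink_strict\<close> applies. \<open>L\<close> depends only on \<delta> and
  \<open>R\<close>.\<close>

lemma cc_dist_lt_between:
  assumes "\<delta> > 0" and "R > 0"
  shows "\<exists>L>0. \<forall>z t w s z\<^sub>1 u\<^sub>1 z\<^sub>2 u\<^sub>2 D.
    norm (z :: complex ^ 'n::finite) \<le> R \<and> norm w \<le> R \<and> \<bar>s\<bar> \<le> R \<and>
    norm z\<^sub>1 \<le> R \<and> \<bar>u\<^sub>1\<bar> \<le> R \<and> norm z\<^sub>2 \<le> R \<and> \<bar>u\<^sub>2\<bar> \<le> R \<and> \<delta> \<le> D - norm (w - z) \<and>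
    cc_dist (z\<^sub>1, u\<^sub>1) (w, s) \<le> D \<and> cc_dist (z\<^sub>2, u\<^sub>2) (w, s) \<le> D \<and>
    u\<^sub>1 < t - L * norm (z\<^sub>1 - z) \<and> t + L * norm (z\<^sub>2 - z) < u\<^sub>2
    \<longrightarrow> cc_dist (z, t) (w, s) < D"
proof -
  obtain C where C: "C > 0" "\<And>a b :: complex ^ 'n. norm (symp a b) \<le> norm a * norm b * C"
    using symp.pos_bounded by blast
  have C': "\<bar>symp a b\<bar> \<le> x * y * C" if "norm a \<le> x" "norm b \<le> y" for a b :: "complex ^ 'n" and x y
  proof -
    have "norm a * norm b * C \<le> x * y * C"
      using that C(1) order_trans[OF norm_ge_zero that(1)]
      by (intro mult_right_mono mult_mono) auto
    then show ?thesis using C(2)[of a b] by simp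
  qed
  \<comment> \<open>A bound for moved relative heights: \<open>2 * R\<close> for the difference of
    heights, 2 for the term \<open>2 * symp z' w\<close>, and 8 for the transport term, whose
    arguments both have norm at most \<open>2 * R\<close>.\<close>
  define M where "M = 2 * R + 10 * (R * R * C)"
  \<comment> \<open>The first summand absorbs the height error of the transport, the second is the
    ratio required by \<open>cc_dist_0_shrink_strict\<close>.\<close>
  define L where "L = 6 * R * C + 2 * M / \<delta>"
  have "M > 0" using assms C(1) by (simp add: M_def add_pos_pos)
  then have "L > 0" using assms C(1) by (simp add: L_def add_pos_pos)
  \<comment> \<open>Appending the horizontal vector \<open>z' - z\<close> changes the relative
    position \<open>w - z'\<close> into \<open>w - z\<close>. The height error is twice a value of
    \<open>symp\<close> with arguments of norm \<open>norm (z' - z)\<close> and at most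
    \<open>3 * R\<close>, whence the 6.\<close>
  have moved: "\<exists>\<tau>'. cc_dist 0 (w - z, \<tau>') \<le> D + norm (z' - z) \<and> \<bar>\<tau>'\<bar> \<le> M \<and>
      \<bar>(s - t - 2 * symp z w) - \<tau>' - (u - t)\<bar> \<le> 6 * R * C * norm (z' - z)"
    if "norm z \<le> R" "norm w \<le> R" "\<bar>s\<bar> \<le> R" "norm z' \<le> R" "\<bar>u\<bar> \<le> R"
      and d: "cc_dist (z', u) (w, s) \<le> D" for z z' w :: "complex ^ 'n" and s t u D
  proof (intro exI conjI)
    let ?\<tau> = "s - u - 2 * symp z' w + 2 * symp (w - z') (z' - z)"
    have "cc_dist 0 ((w - z') + (z' - z), ?\<tau>) \<le> cc_dist 0 (w - z', s - u - 2 * symp z' w) + norm (z' - z)"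
      by (rule cc_dist_0_right_translate)
    then show "cc_dist 0 (w - z, ?\<tau>) \<le> D + norm (z' - z)"
      using d by (simp add: cc_dist_coordinates)
    have "norm (w - z') \<le> 2 * R" "norm (z' - z) \<le> 2 * R"
      using that norm_triangle_ineq4[of w z'] norm_triangle_ineq4[of z' z] by linarith+
    then have "\<bar>symp (w - z') (z' - z)\<bar> \<le> (2 * R) * (2 * R) * C" "\<bar>symp z' w\<bar> \<le> R * R * C"
      using that by (intro C'; simp)+
    then show "\<bar>?\<tau>\<bar> \<le> M"
      using that unfolding M_def by (simp add: algebra_simps)
    have "(s - t - 2 * symp z w) - ?\<tau> - (u - t) = 2 * symp (z' - z) (2 *\<^sub>R w - z')"
      by (simp add: symp.diff_left symp.diff_right symp.scaleR_right symp_commute[of w] symp_commute[of z z'])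
    moreover have "norm (2 *\<^sub>R w - z') \<le> 3 * R"
      using that norm_triangle_ineq4[of "2 *\<^sub>R w" z'] by simp
    then have "\<bar>symp (z' - z) (2 *\<^sub>R w - z')\<bar> \<le> norm (z' - z) * (3 * R) * C"
      by (intro C') auto
    ultimately show "\<bar>(s - t - 2 * symp z w) - ?\<tau> - (u - t)\<bar> \<le> 6 * R * C * norm (z' - z)"
      by (simp add: algebra_simps)
  qed
  have lower: "2 * M * r \<le> \<delta> * x" and pos: "0 < x"
    if "r \<ge> 0" "L * r < y" "\<bar>x - y\<bar> \<le> 6 * R * C * r" for r x y
  proof -
    have *: "2 * M / \<delta> * r < x" using that by (simp add: L_def algebra_simps)
    moreover have "0 \<le> 2 * M / \<delta> * r" using \<open>M > 0\<close> \<open>\<delta> > 0\<close> that by simp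
    ultimately show "0 < x" by linarith
    show "2 * M * r \<le> \<delta> * x" using * \<open>\<delta> > 0\<close> by (simp add: field_simps)
  qed
  have "cc_dist (z, t) (w, s) < D"
    if H: "norm z \<le> R \<and> norm w \<le> R \<and> \<bar>s\<bar> \<le> R \<and>
      norm z\<^sub>1 \<le> R \<and> \<bar>u\<^sub>1\<bar> \<le> R \<and> norm z\<^sub>2 \<le> R \<and> \<bar>u\<^sub>2\<bar> \<le> R \<and> \<delta> \<le> D - norm (w - z) \<and>
      cc_dist (z\<^sub>1, u\<^sub>1) (w, s) \<le> D \<and> cc_dist (z\<^sub>2, u\<^sub>2) (w, s) \<le> D \<and>
      u\<^sub>1 < t - L * norm (z\<^sub>1 - z) \<and> t + L * norm (z\<^sub>2 - z) < u\<^sub>2"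
    for z w z\<^sub>1 z\<^sub>2 :: "complex ^ 'n" and t s u\<^sub>1 u\<^sub>2 D
  proof -
    define \<tau> where "\<tau> = s - t - 2 * symp z w"
    obtain \<tau>\<^sub>1 where \<tau>\<^sub>1: "cc_dist 0 (w - z, \<tau>\<^sub>1) \<le> D + norm (z\<^sub>1 - z)" "\<bar>\<tau>\<^sub>1\<bar> \<le> M"
      "\<bar>\<tau> - \<tau>\<^sub>1 - (u\<^sub>1 - t)\<bar> \<le> 6 * R * C * norm (z\<^sub>1 - z)"
      using moved[of z w s z\<^sub>1 u\<^sub>1 D t] H unfolding \<tau>_def by blast
    obtain \<tau>\<^sub>2 where \<tau>\<^sub>2: "cc_dist 0 (w - z, \<tau>\<^sub>2) \<le> D + norm (z\<^sub>2 - z)" "\<bar>\<tau>\<^sub>2\<bar> \<le> M"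
      "\<bar>\<tau> - \<tau>\<^sub>2 - (u\<^sub>2 - t)\<bar> \<le> 6 * R * C * norm (z\<^sub>2 - z)"
      using moved[of z w s z\<^sub>2 u\<^sub>2 D t] H unfolding \<tau>_def by blast
    have 1: "2 * M * norm (z\<^sub>1 - z) \<le> \<delta> * (\<tau>\<^sub>1 - \<tau>)" "0 < \<tau>\<^sub>1 - \<tau>"
      using \<tau>\<^sub>1(3) H by (intro lower[where y = "t - u\<^sub>1"] pos[where y = "t - u\<^sub>1" and r = "norm (z\<^sub>1 - z)"]; simp)+
    have 2: "2 * M * norm (z\<^sub>2 - z) \<le> \<delta> * (\<tau> - \<tau>\<^sub>2)" "0 < \<tau> - \<tau>\<^sub>2"
      using \<tau>\<^sub>2(3) H by (intro lower[where y = "u\<^sub>2 - t"] pos[where y = "u\<^sub>2 - t" and r = "norm (z\<^sub>2 - z)"]; simp)+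
    have "\<delta> \<le> D - norm (w - z)" using H by blast
    have "cc_dist 0 (w - z, \<tau>) < D"
    \<comment> \<open>Relative heights reverse the order: the lower point gives
      \<open>\<tau>\<^sub>1 > \<tau>\<close>, the upper one \<open>\<tau>\<^sub>2 < \<tau>\<close>.
      The one lying away from 0 is dilated.\<close>
    proof (cases "\<tau> \<ge> 0")
      case True
      then show ?thesis
        using cc_dist_0_shrink_strict[OF \<tau>\<^sub>1(1) norm_ge_zero \<open>\<delta> > 0\<close> \<open>\<delta> \<le> _\<close> _ \<tau>\<^sub>1(2)] 1 by simp
    next
      case False
      then show ?thesis
        using cc_dist_0_shrink_strict[OF \<tau>\<^sub>2(1) norm_ge_zero \<open>\<delta> > 0\<close> \<open>\<delta> \<le> _\<close> _ \<tau>\<^sub>2(2)] 2 by simp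
    qed
    then show ?thesis by (simp add: cc_dist_coordinates \<tau>_def)
  qed
  then show ?thesis using \<open>L > 0\<close> by blast
qed

lemma bounded_heisE:
  assumes "bounded (E :: 'n::finite heis set)"
  obtains R where "R > 0" "\<And>z t. (z, t) \<in> E \<Longrightarrow> norm z \<le> R \<and> \<bar>t\<bar> \<le> R"
proof -
  obtain R where "R > 0" "\<And>p. p \<in> E \<Longrightarrow> norm p \<le> R" using assms bounded_pos by metis
  then show thesis
    using that norm_fst_le norm_snd_le by (metis order_trans real_norm_def)
qed

text \<open>The supremum in \<open>cc_diameter\<close> bounds its members only if they are bounded
  above; the explicit upper bound for the distance supplies this.\<close>

lemma cc_dist_le_diameter:
  assumes "bounded E" and "p \<in> E" "q \<in> E"
  shows "cc_dist p q \<le> cc_diameter (E :: 'n::finite heis set)"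
proof -
  obtain R where R: "R > 0" "\<And>z t. (z, t) \<in> E \<Longrightarrow> norm z \<le> R \<and> \<bar>t\<bar> \<le> R"
    using bounded_heisE[OF assms(1)] by blast
  obtain C where C: "C > 0" "\<And>a b :: complex ^ 'n. norm (symp a b) \<le> norm a * norm b * C"
    using symp.pos_bounded by blast
  have "cc_dist (z, t) (w, s) \<le> 2 * R + 2 * sqrt (2 * R + 2 * (R * R * C))"
    if "(z, t) \<in> E" "(w, s) \<in> E" for z t w s
  proof -
    have zw: "norm z \<le> R" "\<bar>t\<bar> \<le> R" "norm w \<le> R" "\<bar>s\<bar> \<le> R" using R that by auto
    have "norm z * norm w * C \<le> R * R * C"
      using zw C(1) R(1) by (intro mult_mono) auto
    then have "\<bar>symp z w\<bar> \<le> R * R * C" using C(2)[of z w] by simp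
    then have "\<bar>s - t - 2 * symp z w\<bar> \<le> 2 * R + 2 * (R * R * C)" using zw by linarith
    then have "sqrt \<bar>s - t - 2 * symp z w\<bar> \<le> sqrt (2 * R + 2 * (R * R * C))"
      by (rule real_sqrt_le_mono)
    moreover have "norm (w - z) \<le> 2 * R" using norm_triangle_ineq4[of w z] zw by linarith
    ultimately show ?thesis
      unfolding cc_dist_coordinates
      using cc_dist_0_upper[of "w - z" "s - t - 2 * symp z w"] by linarith
  qed
  then have "bdd_above ((\<lambda>(p, q). cc_dist p q) ` (E \<times> E))"
    by (intro bdd_aboveI2[of _ _ "2 * R + 2 * sqrt (2 * R + 2 * (R * R * C))"]) auto
  moreover have "E \<noteq> {}" using assms by blast
  ultimately show ?thesis
    unfolding cc_diameter_def
    using cSUP_upper[of "(p, q)" "E \<times> E" "\<lambda>(p, q). cc_dist p q"] assms by auto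
qed

text \<open>By (NC) the point \<open>[z, t]\<close> is at maximal distance from some point of \<open>E\<close>; points of
  \<open>E\<close> in both of its cones of slope \<open>L\<close> would make this distance smaller.\<close>

lemma frontier_cone:
  fixes E :: "'n::finite heis set"
  assumes "compact E" and NC: "\<forall>p\<in>frontier E. \<exists>q\<in>frontier E. cc_dist p q = cc_diameter E"
    and "\<eta> > 0"
  shows "\<exists>L>0. \<forall>z t a b z\<^sub>1 u\<^sub>1 z\<^sub>2 u\<^sub>2. (z, t) \<in> frontier E \<and> (z, a) \<in> E \<and> (z, b) \<in> E \<and> \<eta> \<le> b - a \<and>
    (z\<^sub>1, u\<^sub>1) \<in> E \<and> (z\<^sub>2, u\<^sub>2) \<in> E \<longrightarrow> \<not> (u\<^sub>1 < t - L * norm (z\<^sub>1 - z) \<and> t + L * norm (z\<^sub>2 - z) < u\<^sub>2)"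
proof -
  let ?D = "cc_diameter E"
  have "bounded E" "closed E" using \<open>compact E\<close> by (auto simp: compact_imp_bounded compact_imp_closed)
  obtain R where R: "R > 0" "\<And>z t. (z, t) \<in> E \<Longrightarrow> norm z \<le> R \<and> \<bar>t\<bar> \<le> R"
    using bounded_heisE[OF \<open>bounded E\<close>] by blast
  obtain \<delta> where "\<delta> > 0" and
    \<delta>: "\<And>z t. \<lbrakk>cc_dist 0 (z :: complex ^ 'n, t) \<le> ?D; \<eta> / 2 \<le> \<bar>t\<bar>\<rbrakk> \<Longrightarrow> \<delta> \<le> ?D - norm z"
    using cc_dist_0_gap[of "\<eta> / 2" ?D] \<open>\<eta> > 0\<close> by (metis half_gt_zero)
  obtain L where "L > 0" and L: "\<And>z t w s z\<^sub>1 u\<^sub>1 z\<^sub>2 u\<^sub>2 D.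
    norm (z :: complex ^ 'n) \<le> R \<and> norm w \<le> R \<and> \<bar>s\<bar> \<le> R \<and>
    norm z\<^sub>1 \<le> R \<and> \<bar>u\<^sub>1\<bar> \<le> R \<and> norm z\<^sub>2 \<le> R \<and> \<bar>u\<^sub>2\<bar> \<le> R \<and> \<delta> \<le> D - norm (w - z) \<and>
    cc_dist (z\<^sub>1, u\<^sub>1) (w, s) \<le> D \<and> cc_dist (z\<^sub>2, u\<^sub>2) (w, s) \<le> D \<and>
    u\<^sub>1 < t - L * norm (z\<^sub>1 - z) \<and> t + L * norm (z\<^sub>2 - z) < u\<^sub>2
    \<Longrightarrow> cc_dist (z, t) (w, s) < D"
    using cc_dist_lt_between[OF \<open>\<delta> > 0\<close> R(1)] by blast
  have False
    if H: "(z, t) \<in> frontier E" "(z, a) \<in> E" "(z, b) \<in> E" "\<eta> \<le> b - a" "(z\<^sub>1, u\<^sub>1) \<in> E" "(z\<^sub>2, u\<^sub>2) \<in> E"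
      "u\<^sub>1 < t - L * norm (z\<^sub>1 - z)" "t + L * norm (z\<^sub>2 - z) < u\<^sub>2" for z t a b z\<^sub>1 u\<^sub>1 z\<^sub>2 u\<^sub>2
  proof -
    obtain w s where q: "(w, s) \<in> frontier E" "cc_dist (z, t) (w, s) = ?D"
      using NC H(1) by fastforce
    then have qE: "(w, s) \<in> E" using frontier_subset_closed[OF \<open>closed E\<close>] by blast
    have le: "cc_dist p (w, s) \<le> ?D" if "p \<in> E" for p
      using cc_dist_le_diameter[OF \<open>bounded E\<close> that qE] .
    \<comment> \<open>The relative heights of \<open>q\<close> seen from \<open>(z, a)\<close> and
      \<open>(z, b)\<close> differ by at least \<eta>, so one of them is at least
      \<open>\<eta> / 2\<close> in absolute value.\<close>
    have "\<delta> \<le> ?D - norm (w - z)"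
    proof (cases "\<eta> / 2 \<le> \<bar>s - a - 2 * symp z w\<bar>")
      case True
      then show ?thesis using le[OF H(2)] by (intro \<delta>) (simp_all add: cc_dist_coordinates)
    next
      case False
      then have "\<eta> / 2 \<le> \<bar>s - b - 2 * symp z w\<bar>" using H(4) by linarith
      then show ?thesis using le[OF H(3)] by (intro \<delta>) (simp_all add: cc_dist_coordinates)
    qed
    then have "cc_dist (z, t) (w, s) < ?D"
      using R(2)[OF H(2)] R(2)[OF H(5)] R(2)[OF H(6)] R(2)[OF qE] le[OF H(5)] le[OF H(6)] H(7,8)
      by (intro L) blast
    then show False using q(2) by simp
  qed
  then show ?thesis using \<open>L > 0\<close> by blast
qed

section \<open>Fibres of sets satisfying (NC)\<close>

text \<open>Fibres of a compact set are compact, so the \<open>GREATEST\<close> and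
  \<open>LEAST\<close> in the definitions are attained.\<close>

lemma upper_lower_fun:
  fixes E :: "'n::finite heis set"
  assumes "compact E" and "z \<in> fst ` E"
  shows "(z, upper_fun E z) \<in> E" "(z, lower_fun E z) \<in> E"
    "\<And>t. (z, t) \<in> E \<Longrightarrow> lower_fun E z \<le> t \<and> t \<le> upper_fun E z"
proof -
  let ?F = "{t. (z, t) \<in> E}"
  have "?F = snd ` (E \<inter> {z} \<times> UNIV)" by force
  moreover have "compact (E \<inter> {z} \<times> UNIV)"
    using assms(1) by (intro compact_Int_closed closed_Times) auto
  ultimately have F: "compact ?F" "?F \<noteq> {}"
    using assms(2) by (auto intro!: compact_continuous_image continuous_intros)
  obtain u where u: "(z, u) \<in> E" "\<And>t. (z, t) \<in> E \<Longrightarrow> t \<le> u"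
    using compact_attains_sup[OF F] by auto
  obtain l where l: "(z, l) \<in> E" "\<And>t. (z, t) \<in> E \<Longrightarrow> l \<le> t"
    using compact_attains_inf[OF F] by auto
  have "upper_fun E z = u" unfolding upper_fun_def by (rule Greatest_equality) (use u in auto)
  moreover have "lower_fun E z = l" unfolding lower_fun_def by (rule Least_equality) (use l in auto)
  ultimately show "(z, upper_fun E z) \<in> E" "(z, lower_fun E z) \<in> E"
    "\<And>t. (z, t) \<in> E \<Longrightarrow> lower_fun E z \<le> t \<and> t \<le> upper_fun E z"
    using u l by auto
qed

text \<open>Fubini: every vertical section has at most one point.\<close>

lemma negligible_single_valued:
  fixes S :: "('a::euclidean_space \<times> 'b::euclidean_space) set"
  assumes "S \<in> sets borel" and "\<And>x y y'. \<lbrakk>(x, y) \<in> S; (x, y') \<in> S\<rbrakk> \<Longrightarrow> y = y'"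
  shows "negligible S"
proof -
  have "emeasure lborel (Pair x -` S) = 0" for x
  proof -
    obtain y where "Pair x -` S \<subseteq> {y}" using assms(2) by (cases "Pair x -` S = {}") auto
    then show ?thesis by (meson countable_finite emeasure_lborel_countable finite.emptyI finite.insertI finite_subset)
  qed
  moreover have "S \<in> sets (lborel \<Otimes>\<^sub>M lborel)" using assms(1) unfolding lborel_prod by simp
  then have "emeasure (lborel \<Otimes>\<^sub>M lborel) S = (\<integral>\<^sup>+x. emeasure lborel (Pair x -` S) \<partial>lborel)"
    by (rule lborel.emeasure_pair_measure_alt)
  ultimately have "emeasure lborel S = 0" by (simp add: lborel_prod)
  then show ?thesis
    using assms(1) by (simp add: negligible_iff_emeasure0)
qed

theorem theorem3p3:
  fixes E :: "'n::finite heis set"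
  assumes "t_convex E"
    and "compact E"
    and NC: "\<forall>p\<in>frontier E. \<exists>q\<in>frontier E. cc_dist p q = cc_diameter E"
  shows
    "(open (thick_set E)
      \<and> locally_lipschitz_on (thick_set E) (lower_fun E)
      \<and> locally_lipschitz_on (thick_set E) (upper_fun E)
      \<and> continuous_on (fst ` E) (lower_fun E)
      \<and> continuous_on (fst ` E) (upper_fun E))
     \<and> emeasure lebesgue E = emeasure lebesgue (hat_set E)
     \<and> (interior E = interior (hat_set E)
      \<and> interior (hat_set E)
          = {(z, t). z \<in> thick_set E \<and> lower_fun E z < t \<and> t < upper_fun E z}
      \<and> frontier (hat_set E)
          = {(z, upper_fun E z) | z. z \<in> closure (thick_set E)}
            \<union> {(z, lower_fun E z) | z. z \<in> closure (thick_set E)}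
      \<and> hat_set E = closure (interior E))"
proof -

  \<comment> \<open>\<open>E\<close> as the region between its end point functions\<close>
  define U where "U = thick_set E"
  define f where "f = upper_fun E"
  define g where "g = lower_fun E"
  define P where "P = fst ` E"
  define V where "V = {(z, t). z \<in> U \<and> g z < t \<and> t < f z}"
  have "closed E" using \<open>compact E\<close> by (rule compact_imp_closed)
  have fE: "(z, f z) \<in> E" and gE: "(z, g z) \<in> E" and gf: "g z \<le> f z" if "z \<in> P" for z
    using upper_lower_fun[OF \<open>compact E\<close>, of z] that by (auto simp: f_def g_def P_def)
  have fibre: "g z \<le> t \<and> t \<le> f z \<and> z \<in> P" if "(z, t) \<in> E" for z t
    using upper_lower_fun(3)[OF \<open>compact E\<close> _ that] that by (force simp: f_def g_def P_def)
  have U: "z \<in> U \<longleftrightarrow> z \<in> P \<and> g z < f z" for z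
    by (auto simp: U_def thick_set_def f_def g_def P_def)
  have between: "(z, t) \<in> E" if "z \<in> P" "g z \<le> t" "t \<le> f z" for z t
    using \<open>t_convex E\<close> fE gE that unfolding t_convex_def by (meson atLeastAtMost_iff order_trans)
  have E_iff: "(z, t) \<in> E \<longleftrightarrow> z \<in> P \<and> g z \<le> t \<and> t \<le> f z" for z t
    using fibre between by blast
  have "compact P" unfolding P_def
    by (intro compact_continuous_image continuous_intros \<open>compact E\<close>)
  then have "closed P" by (rule compact_imp_closed)
  have "closure U \<subseteq> P" by (rule closure_minimal) (use U \<open>closed P\<close> in auto)

  \<comment> \<open>Cones and the interior of \<open>E\<close>\<close>
  define cone_free where "cone_free \<eta> L \<longleftrightarrow> (\<forall>z t a b z\<^sub>1 u\<^sub>1 z\<^sub>2 u\<^sub>2.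
      (z, t) \<in> frontier E \<and> (z, a) \<in> E \<and> (z, b) \<in> E \<and> \<eta> \<le> b - a \<and> (z\<^sub>1, u\<^sub>1) \<in> E \<and> (z\<^sub>2, u\<^sub>2) \<in> E
      \<longrightarrow> \<not> (u\<^sub>1 < t - L * norm (z\<^sub>1 - z) \<and> t + L * norm (z\<^sub>2 - z) < u\<^sub>2))" for \<eta> L
  have ex_cone_free: "\<exists>L>0. cone_free \<eta> L" if "\<eta> > 0" for \<eta>
    unfolding cone_free_def by (rule frontier_cone[OF \<open>compact E\<close> NC that])
  have cone_freeD: "\<not> (u\<^sub>1 < t - L * norm (z\<^sub>1 - z) \<and> t + L * norm (z\<^sub>2 - z) < u\<^sub>2)"
    if "cone_free \<eta> L" "(z, t) \<in> frontier E" "(z, a) \<in> E" "(z, b) \<in> E" "\<eta> \<le> b - a"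
      "(z\<^sub>1, u\<^sub>1) \<in> E" "(z\<^sub>2, u\<^sub>2) \<in> E" for \<eta> L z t a b z\<^sub>1 u\<^sub>1 z\<^sub>2 u\<^sub>2
    using that unfolding cone_free_def by blast

  have V_subset: "V \<subseteq> interior E"
  proof
    fix p assume "p \<in> V"
    then obtain z t where p: "p = (z, t)" "z \<in> U" "g z < t" "t < f z" by (auto simp: V_def)
    then have "z \<in> P" "0 < f z - g z" using U by simp_all
    then obtain L where "cone_free (f z - g z) L" using ex_cone_free by blast
    \<comment> \<open>Both cone points are taken on the fibre itself, where the offsets vanish: no
      frontier point lies strictly between the ends of a fibre.\<close>
    from cone_freeD[OF this, of z t "g z" "f z" z "g z" z "f z"] have "(z, t) \<notin> frontier E"
      using p fE[OF \<open>z \<in> P\<close>] gE[OF \<open>z \<in> P\<close>] by auto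
    moreover have "(z, t) \<in> closure E"
      using between[OF \<open>z \<in> P\<close>, of t] p closure_subset by fastforce
    ultimately show "p \<in> interior E" by (simp add: frontier_def p)
  qed
  have slice: "open {z. (z, t) \<in> interior E}" for t
  proof -
    have "continuous_on UNIV (\<lambda>z. (z, t))" by (intro continuous_intros)
    from open_vimage[OF open_interior this, of E] show ?thesis by (simp add: vimage_def)
  qed
  have interior_P: "z \<in> P \<and> g z < t \<and> t < f z" if "(z, t) \<in> interior E" for z t
  proof -
    have "continuous_on UNIV (\<lambda>s. (z, s))" by (intro continuous_intros)
    from open_vimage[OF open_interior this, of E] have "open {s. (z, s) \<in> interior E}"
      by (simp add: vimage_def)
    moreover have "t \<in> {s. (z, s) \<in> interior E}" using that by simp
    ultimately obtain e where e: "e > 0" "ball t e \<subseteq> {s. (z, s) \<in> interior E}"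
      by (rule openE)
    have "t - e / 2 \<in> ball t e" "t + e / 2 \<in> ball t e"
      using \<open>e > 0\<close> by (simp_all add: dist_real_def)
    then have "(z, t - e / 2) \<in> E" "(z, t + e / 2) \<in> E"
      using e(2) interior_subset[of E] by blast+
    then show ?thesis using fibre[of z "t - e / 2"] fibre[of z "t + e / 2"] \<open>e > 0\<close> by auto
  qed
  then have "interior E \<subseteq> V" unfolding V_def using U by fastforce
  then have int_E: "interior E = V" using V_subset by blast

  \<comment> \<open>Openness of \<open>U\<close> and local Lipschitz bounds\<close>
  have local: "\<exists>r>0. ball z r \<subseteq> U \<and> (\<exists>L. L-lipschitz_on (ball z r) f \<and> L-lipschitz_on (ball z r) g)"
    if "z \<in> U" for z
  proof -
    \<comment> \<open>Two interior levels at the thirds of the fibre remain interior over nearby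
      points. Hence nearby fibres have length at least \<open>m' - m\<close>, and one slope serves
      them all.\<close>
    define m where "m = (2 * g z + f z) / 3"
    define m' where "m' = (g z + 2 * f z) / 3"
    have m: "g z < m" "m < m'" "m' < f z" using that U by (auto simp: m_def m'_def)
    have "open ({z. (z, m) \<in> interior E} \<inter> {z. (z, m') \<in> interior E})" by (intro open_Int slice)
    moreover have "z \<in> {z. (z, m) \<in> interior E} \<inter> {z. (z, m') \<in> interior E}"
      using V_subset m that by (auto simp: V_def)
    ultimately obtain r where "r > 0" and r: "ball z r \<subseteq> {z. (z, m) \<in> interior E} \<inter> {z. (z, m') \<in> interior E}"
      using openE by blast
    have ball: "x \<in> P" "g x < m" "m < f x" "g x < m'" "m' < f x" if "x \<in> ball z r" for x
      using interior_P[of x m] interior_P[of x m'] r that by auto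
    have "0 < m' - m" using m by simp
    then obtain L where "L > 0" and L: "cone_free (m' - m) L" using ex_cone_free by blast
    have front: "(x, t) \<in> frontier E" if "x \<in> ball z r" "t = f x \<or> t = g x" for x t
      using interior_P[of x t] fE[of x] gE[of x] ball(1)[of x] that closure_subset[of E]
      by (auto simp: frontier_def)
    \<comment> \<open>The lower end \<open>(x, g x)\<close> already occupies the downward cone at
      \<open>(x, f x)\<close>, so the upward cone contains no point of \<open>E\<close>.\<close>
    have f_le: "f y \<le> f x + L * norm (y - x)" if "x \<in> ball z r" "y \<in> ball z r" for x y
      using cone_freeD[OF L, of x "f x" "g x" "f x" x "g x" y "f y"] front[of x "f x"]
        fE[of x] gE[of x] fE[of y] ball[of x] ball[of y] that
      by force
    have g_ge: "g x - L * norm (y - x) \<le> g y" if "x \<in> ball z r" "y \<in> ball z r" for x y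
      using cone_freeD[OF L, of x "g x" "g x" "f x" y "g y" x "f x"] front[of x "g x"]
        fE[of x] gE[of x] gE[of y] ball[of x] ball[of y] that
      by force
    have "L-lipschitz_on (ball z r) f"
    proof (rule lipschitz_onI)
      fix x y assume "x \<in> ball z r" "y \<in> ball z r"
      then show "dist (f x) (f y) \<le> L * dist x y"
        using f_le[of x y] f_le[of y x] by (auto simp: dist_real_def dist_norm norm_minus_commute[of y x])
    qed (use \<open>L > 0\<close> in simp)
    moreover have "L-lipschitz_on (ball z r) g"
    proof (rule lipschitz_onI)
      fix x y assume "x \<in> ball z r" "y \<in> ball z r"
      then show "dist (g x) (g y) \<le> L * dist x y"
        using g_ge[of x y] g_ge[of y x] by (auto simp: dist_real_def dist_norm norm_minus_commute[of y x])
    qed (use \<open>L > 0\<close> in simp)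
    moreover have "ball z r \<subseteq> U" using ball m U by fastforce
    ultimately show ?thesis using \<open>r > 0\<close> by blast
  qed
  have "open U" unfolding open_contains_ball using local by blast
  have lip: "locally_lipschitz_on U f" "locally_lipschitz_on U g"
    unfolding locally_lipschitz_on_def using local by (metis Int_absorb2)+

  \<comment> \<open>Continuity up to the one-point fibres\<close>
  have in_P: "\<forall>\<^sub>F x in at z within P. x \<in> P" for z
    by (simp add: eventually_at_filter)
  \<comment> \<open>Superlevel sets of \<open>f\<close> are projections of compact sets:
    \<open>f\<close> is upper semicontinuous, and dually \<open>g\<close> is lower
    semicontinuous.\<close>
  have closed_f: "closed {z \<in> P. c \<le> f z}" for c
  proof -
    have "{z \<in> P. c \<le> f z} = fst ` (E \<inter> UNIV \<times> {c..})"
      using fE by (force simp: E_iff)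
    moreover have "compact (E \<inter> UNIV \<times> {c..})"
      by (intro compact_Int_closed closed_Times \<open>compact E\<close>) auto
    ultimately show ?thesis by (auto intro!: compact_imp_closed compact_continuous_image continuous_intros)
  qed
  have f_usc: "\<forall>\<^sub>F x in at z within P. f x < c" if "f z < c" for z c
  proof -
    have "\<forall>\<^sub>F x in at z within P. x \<in> - {z \<in> P. c \<le> f z}"
      by (rule topological_tendstoD[OF tendsto_ident_at]) (use closed_f that in auto)
    with in_P[of z] show ?thesis by eventually_elim auto
  qed
  have closed_g: "closed {z \<in> P. g z \<le> c}" for c
  proof -
    have "{z \<in> P. g z \<le> c} = fst ` (E \<inter> UNIV \<times> {..c})"
      using gE by (force simp: E_iff)
    moreover have "compact (E \<inter> UNIV \<times> {..c})"
      by (intro compact_Int_closed closed_Times \<open>compact E\<close>) auto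
    ultimately show ?thesis by (auto intro!: compact_imp_closed compact_continuous_image continuous_intros)
  qed
  have g_lsc: "\<forall>\<^sub>F x in at z within P. c < g x" if "c < g z" for z c
  proof -
    have "\<forall>\<^sub>F x in at z within P. x \<in> - {z \<in> P. g z \<le> c}"
      by (rule topological_tendstoD[OF tendsto_ident_at]) (use closed_g that in auto)
    with in_P[of z] show ?thesis by eventually_elim auto
  qed
  have cont: "(f \<longlongrightarrow> f z) (at z within P) \<and> (g \<longlongrightarrow> g z) (at z within P)" if "z \<in> P" for z
  proof (cases "z \<in> U")
    case True
    then obtain r L where r: "r > 0" "L-lipschitz_on (ball z r) f" "L-lipschitz_on (ball z r) g"
      using local by blast
    then have "isCont f z" "isCont g z"
      by (auto intro: continuous_on_interior[of "ball z r"] lipschitz_on_continuous_on)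
    then show ?thesis by (auto simp: isCont_def intro: tendsto_within_subset)
  next
    case False
    then have "f z = g z" using that gf[OF that] U by auto
    have "(f \<longlongrightarrow> f z) (at z within P)"
    proof (rule order_tendstoI)
      fix c assume "c < f z"
      \<comment> \<open>Since \<open>g \<le> f\<close> with equality at \<open>z\<close>, lower
        semicontinuity of \<open>g\<close> passes to \<open>f\<close>.\<close>
      then have "\<forall>\<^sub>F x in at z within P. c < g x" using g_lsc \<open>f z = g z\<close> by simp
      then show "\<forall>\<^sub>F x in at z within P. c < f x"
        using in_P by eventually_elim (use gf in fastforce)
    qed (rule f_usc)
    moreover have "(g \<longlongrightarrow> g z) (at z within P)"
    proof (rule order_tendstoI)
      fix c assume "g z < c"
      then have "\<forall>\<^sub>F x in at z within P. f x < c" using f_usc \<open>f z = g z\<close> by simp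
      then show "\<forall>\<^sub>F x in at z within P. g x < c"
        using in_P by eventually_elim (use gf in fastforce)
    qed (rule g_lsc)
    ultimately show ?thesis ..
  qed
  then have cont_f: "continuous_on P f" and cont_g: "continuous_on P g"
    by (auto simp: continuous_on_def)

  \<comment> \<open>Interior, frontier and closure of the hat set\<close>
  have hat: "hat_set E = {(z, t). z \<in> closure U \<and> g z \<le> t \<and> t \<le> f z}"
    by (simp add: hat_set_def U_def f_def g_def)
  have hat_E: "hat_set E = E \<inter> closure U \<times> UNIV"
    using \<open>closure U \<subseteq> P\<close> by (auto simp: hat E_iff)
  then have "closed (hat_set E)" by (simp add: \<open>closed E\<close> closed_Int closed_Times)
  have "V \<subseteq> hat_set E" using closure_subset by (auto simp: hat V_def)
  have int_hat: "interior (hat_set E) = V"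
  proof
    show "interior (hat_set E) \<subseteq> V" using interior_mono[of "hat_set E" E] hat_E int_E by auto
    show "V \<subseteq> interior (hat_set E)"
      using \<open>V \<subseteq> hat_set E\<close> int_E open_interior by (metis interior_maximal)
  qed
  have frontier_hat: "frontier (hat_set E)
      = {(z, f z) | z. z \<in> closure U} \<union> {(z, g z) | z. z \<in> closure U}"
    using \<open>closed (hat_set E)\<close> \<open>closure U \<subseteq> P\<close> gf
    unfolding frontier_def int_hat by (auto simp: hat V_def U)
  have "hat_set E = closure V"
  proof
    show "closure V \<subseteq> hat_set E"
      by (rule closure_minimal) fact+
    show "hat_set E \<subseteq> closure V"
    proof
      fix p assume "p \<in> hat_set E"
      then obtain z t where p: "p = (z, t)" "z \<in> closure U" "g z \<le> t" "t \<le> f z" by (auto simp: hat)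
      show "p \<in> closure V"
      proof (cases "z \<in> U")
        case True
        have "Pair z ` closure {g z<..<f z} \<subseteq> closure V"
          by (rule image_closure_subset)
            (use True closure_subset in \<open>force simp: V_def intro!: continuous_intros\<close>)+
        moreover have "t \<in> closure {g z<..<f z}" using True U p by auto
        ultimately show ?thesis using p(1) by blast
      next
        case False
        then have "t = f z" "f z = g z" using p U \<open>closure U \<subseteq> P\<close> by force+
        \<comment> \<open>A one-point fibre over the closure of \<open>U\<close> is the limit of
          midpoints of fibres over \<open>U\<close>; continuity of \<open>f\<close> and
          \<open>g\<close> up to \<open>z\<close> is essential here.\<close>
        obtain x where x: "\<And>k. x k \<in> U" "x \<longlonglongrightarrow> z"
          using p(2) closure_sequential by blast
        have xP: "\<And>k. x k \<in> P" "z \<in> P" using x(1) U p(2) \<open>closure U \<subseteq> P\<close> by auto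
        have "(\<lambda>k. f (x k)) \<longlonglongrightarrow> f z" "(\<lambda>k. g (x k)) \<longlonglongrightarrow> g z"
          using cont_f cont_g xP x(2) unfolding continuous_on_sequentially o_def by blast+
        then have "(\<lambda>k. (x k, (f (x k) + g (x k)) / 2)) \<longlonglongrightarrow> (z, (f z + g z) / 2)"
          by (intro tendsto_Pair x(2) tendsto_divide tendsto_add) auto
        moreover have "(x k, (f (x k) + g (x k)) / 2) \<in> V" for k
          using x(1)[of k] U by (auto simp: V_def)
        moreover have "(z, (f z + g z) / 2) = p" using p(1) \<open>t = f z\<close> \<open>f z = g z\<close> by simp
        ultimately show ?thesis
          unfolding closure_sequential by (intro exI[of _ "\<lambda>k. (x k, (f (x k) + g (x k)) / 2)"]) simp
      qed
    qed
  qed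

  \<comment> \<open>Equality of the measures\<close>
  moreover have "emeasure lebesgue E = emeasure lebesgue (hat_set E)"
  proof -
    have borel: "E \<in> sets borel" "hat_set E \<in> sets borel"
      using \<open>closed E\<close> \<open>closed (hat_set E)\<close> by auto
    \<comment> \<open>The removed points lie outside the closure of \<open>U\<close>, where each
      fibre is a single point.\<close>
    have "negligible (E - hat_set E)"
    proof (rule negligible_single_valued)
      show "E - hat_set E \<in> sets borel" using borel by auto
      fix z t t' assume "(z, t) \<in> E - hat_set E" "(z, t') \<in> E - hat_set E"
      then have "(z, t) \<in> E" "(z, t') \<in> E" "z \<notin> U" using closure_subset by (auto simp: hat_E)
      then show "t = t'" using U fibre[of z t] fibre[of z t'] by force
    qed
    then have "E - hat_set E \<in> null_sets lebesgue" by (simp add: negligible_iff_null_sets)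
    moreover have "E = hat_set E \<union> (E - hat_set E)" using hat_E by blast
    ultimately show ?thesis using emeasure_Un_null_set[of "hat_set E" lebesgue "E - hat_set E"] borel(2) by auto
  qed
  ultimately show ?thesis
    using \<open>open U\<close> lip cont_f cont_g int_E int_hat frontier_hat
    by (simp add: U_def f_def g_def P_def V_def)
qed

end
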